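(* Let $\{S(t):t\geq 0\}$ be a real-valued Lévy process such that $\kappa_S(\theta):=\log\mathbb{E}[e^{\theta S(1)}]$ is finite in a neighborhood of $\theta=0$. Let $f:[0,\infty)\to\mathbb{R}$ be a differentiable, convex and non-decreasing function with $f(0)=0$ and $f'(0)=0$ (right derivative at $0$), and let $\{L_f(t):t\geq 0\}$ be a nonnegative process, independent of $\{S(t):t\geq 0\}$, such that for every $\rho\in\mathbb{R}$ the following limit exists and satisfies $$\lim_{t\to\infty}\frac{1}{t}\log\mathbb{E}[e^{\rho L_f(t)}]=\Upsilon_f(\rho):=\begin{cases} f(\rho) & \text{if } \rho\geq 0,\\ 0 & \text{if } \rho<0.\end{cases}$$ Consider the function $$\Lambda_{f,S}(\theta):=\Upsilon_f(\kappa_S(\theta))=\begin{cases} f(\kappa_S(\theta)) & \text{if } \kappa_S(\theta)\geq 0,\\ 0 & \text{if } \kappa_S(\theta)<0,\end{cases}$$ and assume that it is an essentially smooth function. Then $\left\{\frac{S(L_f(t))}{t}:t>0\right\}$ satisfies the large deviation principle (as $t\to\infty$) with speed $v_t=t$ and good rate function $I_{\mathrm{LD},f}$ defined by $$I_{\mathrm{LD},f}(x):=\sup_{\theta\in\mathbb{R}}\{\theta x-\Lambda_{f,S}(\theta)\}.$$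
   Context: The function $\kappa_S$ takes values in $(-\infty,\infty]$, and $f(\infty)=\infty$ by convention. Large deviation principle (LDP): a family of real random variables $\{Z(t):t>0\}$ satisfies the LDP with speed $v_t\to\infty$ and rate function $I:\mathbb{R}\to[0,\infty]$ (lower semicontinuous) if $\limsup_{t\to\infty}\frac{1}{v_t}\log P(Z(t)\in C)\leq-\inf_{x\in C}I(x)$ for all closed sets $C$ and $\liminf_{t\to\infty}\frac{1}{v_t}\log P(Z(t)\in O)\geq-\inf_{x\in O}I(x)$ for all open sets $O$. The rate function $I$ is good if all level sets $\{x\in\mathbb{R}:I(x)\leq b\}$, $b\geq 0$, are compact. Essentially smooth: a function $\Lambda:\mathbb{R}\to(-\infty,\infty]$ with $\mathcal{D}(\Lambda):=\{\theta\in\mathbb{R}:\Lambda(\theta)<\infty\}$ is essentially smooth if the interior of $\mathcal{D}(\Lambda)$ is non-empty, $\Lambda$ is differentiable throughout this interior, and $\Lambda$ is steep, i.e. $|\Lambda'(\theta_n)|\to\infty$ whenever $(\theta_n)$ is a sequence in the interior of $\mathcal{D}(\Lambda)$ converging to a boundary point of $\mathcal{D}(\Lambda)$. *)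

theory Defs
  imports "HOL-Probability.Probability"
begin

section \<open>Extended logarithm and cumulant generating functions\<close>

definition elog :: "ennreal \<Rightarrow> ereal" where
  "elog x = (if x = 0 then - \<infinity> else if x = top then \<infinity> else ereal (ln (enn2real x)))"

text \<open>The value is \<open>\<infinity>\<close> when the exponential moment is infinite.\<close>

definition log_mgf :: "'a measure \<Rightarrow> ('a \<Rightarrow> real) \<Rightarrow> real \<Rightarrow> ereal" where
  "log_mgf M X \<theta> = elog (\<integral>\<^sup>+\<omega>. ennreal (exp (\<theta> * X \<omega>)) \<partial>M)"

section \<open>Levy processes\<close>

definition cadlag_path :: "(real \<Rightarrow> real) \<Rightarrow> bool" where
  "cadlag_path p \<longleftrightarrow>
     (\<forall>t\<ge>0. (p \<longlongrightarrow> p t) (at_right t)) \<and> (\<forall>t>0. \<exists>l. (p \<longlongrightarrow> l) (at_left t))"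

text \<open>Processes are indexed by type \<^typ>\<open>real\<close>; only times \<open>t \<ge> 0\<close> are constrained.\<close>

definition levy_process :: "'a measure \<Rightarrow> (real \<Rightarrow> 'a \<Rightarrow> real) \<Rightarrow> bool" where
  "levy_process M S \<longleftrightarrow>
     prob_space M \<and>
     (\<forall>t\<ge>0. S t \<in> borel_measurable M) \<and>
     (AE \<omega> in M. S 0 \<omega> = 0) \<and>
     (\<forall>(n::nat) \<tau>. 0 \<le> \<tau> 0 \<and> (\<forall>i<n. \<tau> i < \<tau> (Suc i)) \<longrightarrow>
        prob_space.indep_vars M (\<lambda>_. borel) (\<lambda>i \<omega>. S (\<tau> (Suc i)) \<omega> - S (\<tau> i) \<omega>) {..<n}) \<and>
     (\<forall>s\<ge>0. \<forall>t\<ge>0. distr M borel (\<lambda>\<omega>. S (s + t) \<omega> - S s \<omega>) = distr M borel (S t)) \<and>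
     (\<forall>t\<ge>0. \<forall>\<epsilon>>0.
        ((\<lambda>u. measure M {\<omega> \<in> space M. \<bar>S u \<omega> - S t \<omega>\<bar> > \<epsilon>}) \<longlongrightarrow> 0) (at t within {0..})) \<and>
     (AE \<omega> in M. cadlag_path (\<lambda>t. S t \<omega>))"

definition indep_processes ::
  "'a measure \<Rightarrow> (real \<Rightarrow> 'a \<Rightarrow> real) \<Rightarrow> (real \<Rightarrow> 'a \<Rightarrow> real) \<Rightarrow> bool" where
  "indep_processes M X Y \<longleftrightarrow>
     prob_space.indep_var M
       (Pi\<^sub>M {0..} (\<lambda>_. borel)) (\<lambda>\<omega>. \<lambda>t\<in>{0..}. X t \<omega>)
       (Pi\<^sub>M {0..} (\<lambda>_. borel)) (\<lambda>\<omega>. \<lambda>t\<in>{0..}. Y t \<omega>)"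

section \<open>Large deviations\<close>

definition rate_function :: "(real \<Rightarrow> ereal) \<Rightarrow> bool" where
  "rate_function I \<longleftrightarrow> (\<forall>x. 0 \<le> I x) \<and> (\<forall>x. I x \<le> Liminf (at x) I)"

definition good_rate_function :: "(real \<Rightarrow> ereal) \<Rightarrow> bool" where
  "good_rate_function I \<longleftrightarrow>
     rate_function I \<and> (\<forall>b::real. 0 \<le> b \<longrightarrow> compact {x. I x \<le> ereal b})"

definition satisfies_LDP ::
  "'a measure \<Rightarrow> (real \<Rightarrow> 'a \<Rightarrow> real) \<Rightarrow> (real \<Rightarrow> real) \<Rightarrow> (real \<Rightarrow> ereal) \<Rightarrow> bool" where
  "satisfies_LDP M Z v I \<longleftrightarrow>
     prob_space M \<and> (\<forall>t>0. Z t \<in> borel_measurable M) \<and>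
     filterlim v at_top at_top \<and> rate_function I \<and>
     (\<forall>C. closed C \<longrightarrow>
        Limsup at_top (\<lambda>t. ereal (1 / v t) * elog (emeasure M {\<omega> \<in> space M. Z t \<omega> \<in> C}))
          \<le> - (INF x\<in>C. I x)) \<and>
     (\<forall>U. open U \<longrightarrow>
        - (INF x\<in>U. I x)
          \<le> Liminf at_top (\<lambda>t. ereal (1 / v t) * elog (emeasure M {\<omega> \<in> space M. Z t \<omega> \<in> U})))"

section \<open>Essential smoothness\<close>

definition eff_domain :: "(real \<Rightarrow> ereal) \<Rightarrow> real set" where
  "eff_domain \<Lambda> = {\<theta>. \<Lambda> \<theta> < \<infinity>}"

definition essentially_smooth :: "(real \<Rightarrow> ereal) \<Rightarrow> bool" where
  "essentially_smooth \<Lambda> \<longleftrightarrow>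
     (\<forall>\<theta>. \<Lambda> \<theta> \<noteq> - \<infinity>) \<and>
     interior (eff_domain \<Lambda>) \<noteq> {} \<and>
     (\<forall>\<theta>\<in>interior (eff_domain \<Lambda>). (\<lambda>u. real_of_ereal (\<Lambda> u)) differentiable (at \<theta>)) \<and>
     (\<forall>\<theta>s \<theta>. (\<forall>n::nat. \<theta>s n \<in> interior (eff_domain \<Lambda>)) \<and> \<theta>s \<longlonglongrightarrow> \<theta> \<and>
        \<theta> \<in> frontier (eff_domain \<Lambda>) \<longrightarrow>
        filterlim (\<lambda>n. \<bar>deriv (\<lambda>u. real_of_ereal (\<Lambda> u)) (\<theta>s n)\<bar>) at_top sequentially)"

section \<open>The functions of the time-changed process\<close>

text \<open>\<open>Upsilon f\<close> is defined on extended arguments, with the convention \<open>f \<infinity> = \<infinity>\<close>.\<close>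

definition Upsilon :: "(real \<Rightarrow> real) \<Rightarrow> ereal \<Rightarrow> ereal" where
  "Upsilon f y =
     (if 0 \<le> y then (if y = \<infinity> then \<infinity> else ereal (f (real_of_ereal y))) else 0)"

definition kappa :: "'a measure \<Rightarrow> (real \<Rightarrow> 'a \<Rightarrow> real) \<Rightarrow> real \<Rightarrow> ereal" where
  "kappa M S \<theta> = log_mgf M (S 1) \<theta>"

definition Lambda_fS :: "'a measure \<Rightarrow> (real \<Rightarrow> real) \<Rightarrow> (real \<Rightarrow> 'a \<Rightarrow> real) \<Rightarrow> real \<Rightarrow> ereal" where
  "Lambda_fS M f S \<theta> = Upsilon f (kappa M S \<theta>)"

definition I_LD :: "'a measure \<Rightarrow> (real \<Rightarrow> real) \<Rightarrow> (real \<Rightarrow> 'a \<Rightarrow> real) \<Rightarrow> real \<Rightarrow> ereal" where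
  "I_LD M f S x = (SUP \<theta>. ereal (\<theta> * x) - Lambda_fS M f S \<theta>)"

end

theory Submission
  imports Defs
begin

text \<open>A Levy process has \<open>E (exp (\<theta> * S s)) = exp (\<kappa> \<theta> * s)\<close>, where \<open>\<kappa>\<close> is the cumulant generating function of
\<open>S 1\<close>. Conditioning on the independent time \<open>L t\<close> therefore gives
\<open>E (exp (\<theta> * S (L t))) = E (exp (\<kappa> \<theta> * L t))\<close> whenever \<open>\<kappa> \<theta>\<close> is finite
(lemma \<open>log_mgf_time_changed_levy\<close>), so the scaled logarithmic moments of \<open>S (L t)\<close> converge to
\<open>Upsilon f (\<kappa> \<theta>)\<close> on the effective domain of \<^const>\<open>Lambda_fS\<close>, which contains a neighbourhood of \<open>0\<close>. The theorem
is then an instance of the Gaertner-Ellis theorem on the line (\<open>gartner_ellis_real\<close>).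

The Gaertner-Ellis theorem combines three facts. Chernoff bounds and a finite cover by half-lines give the upper bound for
closed sets and the goodness of the rate function. Exponential tilting (\<open>tilted_lower_bound\<close>) gives the lower bound near
each slope of the limit function. A deterministic lemma about steep functions (\<open>steep_slope_approx\<close>) shows that every
point with a finite rate is a limit of slopes at which the rate is no larger, which extends the lower bound to all open
sets.

Two points about the time change require care. The exponential formula at all real times needs some regularity in \<open>s\<close>,
supplied by stochastic continuity; and conditioning on \<open>L t\<close> needs evaluation of a path at a random time to be jointly
measurable, which is arranged by evaluating along a discrete grid from the right
(\<open>nn_integral_independent_time_change\<close>).\<close>

section \<open>Exponential rates\<close>

text \<open>The factor \<open>1 / t\<close> together with \<^const>\<open>elog\<close> turns bounds on a linear exponential scale into bounds
on extended reals. With these equivalences all estimates below take place in \<^typ>\<open>ennreal\<close>, where the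
values \<open>0\<close> and \<open>\<infinity>\<close> need no separate treatment.\<close>

lemma scaled_elog_le_iff:
  assumes "t > 0"
  shows "ereal (1 / t) * elog x \<le> ereal r \<longleftrightarrow> x \<le> ennreal (exp (t * r))"
proof (cases x)
  case (real a)
  show ?thesis
  proof (cases "a = 0")
    case True then show ?thesis using assms real by (simp add: elog_def)
  next
    case False
    then have a: "a > 0" using real by simp
    have "ereal (1 / t) * elog x \<le> ereal r \<longleftrightarrow> ln a \<le> t * r"
      using a real assms by (simp add: elog_def field_simps)
    also have "\<dots> \<longleftrightarrow> a \<le> exp (t * r)" using a by (metis exp_le_cancel_iff exp_ln)
    finally show ?thesis using real a by simp
  qed
next
  case top
  then show ?thesis using assms by (auto simp: elog_def top_unique)
qed

lemma le_scaled_elog_iff: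
  assumes "t > 0"
  shows "ereal r \<le> ereal (1 / t) * elog x \<longleftrightarrow> ennreal (exp (t * r)) \<le> x"
proof (cases x)
  case (real a)
  show ?thesis
  proof (cases "a = 0")
    case True then show ?thesis using assms real by (simp add: elog_def)
  next
    case False
    then have a: "a > 0" using real by simp
    have "ereal r \<le> ereal (1 / t) * elog x \<longleftrightarrow> t * r \<le> ln a"
      using a real assms by (simp add: elog_def field_simps)
    also have "\<dots> \<longleftrightarrow> exp (t * r) \<le> a" using a by (metis exp_le_cancel_iff exp_ln)
    finally show ?thesis using real a by simp
  qed
next
  case top
  then show ?thesis using assms by (auto simp: elog_def)
qed

lemma elog_eq_ereal_iff: "elog x = ereal r \<longleftrightarrow> x = ennreal (exp r)"
  using scaled_elog_le_iff[of 1 x r] le_scaled_elog_iff[of 1 r x] by (simp add: order_eq_iff one_ereal_def[symmetric])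

lemma scaled_log_mgf_eventually_between:
  assumes lim: "((\<lambda>t. ereal (1 / t) * log_mgf M (W t) \<theta>) \<longlongrightarrow> ereal l) at_top"
    and "\<epsilon> > 0"
  shows "\<forall>\<^sub>F t in at_top. (\<integral>\<^sup>+\<omega>. ennreal (exp (\<theta> * W t \<omega>)) \<partial>M) \<le> ennreal (exp (t * (l + \<epsilon>)))"
    and "\<forall>\<^sub>F t in at_top. ennreal (exp (t * (l - \<epsilon>))) \<le> (\<integral>\<^sup>+\<omega>. ennreal (exp (\<theta> * W t \<omega>)) \<partial>M)"
proof -
  have "\<forall>\<^sub>F t in at_top. ereal (1 / t) * log_mgf M (W t) \<theta> < ereal (l + \<epsilon>)"
    using lim \<open>\<epsilon> > 0\<close> by (intro order_tendstoD(2)) auto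
  then show "\<forall>\<^sub>F t in at_top. (\<integral>\<^sup>+\<omega>. ennreal (exp (\<theta> * W t \<omega>)) \<partial>M) \<le> ennreal (exp (t * (l + \<epsilon>)))"
    using eventually_gt_at_top[of 0]
    by eventually_elim (simp add: log_mgf_def flip: scaled_elog_le_iff)
  have "\<forall>\<^sub>F t in at_top. ereal (l - \<epsilon>) < ereal (1 / t) * log_mgf M (W t) \<theta>"
    using lim \<open>\<epsilon> > 0\<close> by (intro order_tendstoD(1)) auto
  then show "\<forall>\<^sub>F t in at_top. ennreal (exp (t * (l - \<epsilon>))) \<le> (\<integral>\<^sup>+\<omega>. ennreal (exp (\<theta> * W t \<omega>)) \<partial>M)"
    using eventually_gt_at_top[of 0]
    by eventually_elim (simp add: log_mgf_def flip: le_scaled_elog_iff)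
qed

section \<open>Slopes of a steep function\<close>

text \<open>Derivatives have the intermediate value property even where they are discontinuous. If \<open>g' b > x\<close>, then
\<open>\<theta> \<mapsto> x * \<theta> - g \<theta>\<close> increases at \<open>a\<close> and decreases at \<open>b\<close>, so its maximum over \<open>[a, b]\<close> is an interior
critical point.\<close>

lemma derivative_intermediate_value:
  fixes g g' :: "real \<Rightarrow> real"
  assumes "a \<le> b" and der: "\<And>\<theta>. a \<le> \<theta> \<Longrightarrow> \<theta> \<le> b \<Longrightarrow> (g has_real_derivative g' \<theta>) (at \<theta>)"
    and lo: "g' a < x" and hi: "x \<le> g' b"
  shows "\<exists>\<theta>. a \<le> \<theta> \<and> \<theta> \<le> b \<and> g' \<theta> = x"
proof (cases "g' b = x")
  case True
  then show ?thesis using \<open>a \<le> b\<close> by blast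
next
  case False
  define h where "h \<theta> = x * \<theta> - g \<theta>" for \<theta>
  have derh: "(h has_real_derivative x - g' \<theta>) (at \<theta>)" if "a \<le> \<theta>" "\<theta> \<le> b" for \<theta>
    unfolding h_def using der[OF that] by (auto intro!: derivative_eq_intros)
  have "continuous_on {a..b} h"
    by (meson DERIV_isCont atLeastAtMost_iff continuous_at_imp_continuous_on derh)
  then obtain c where c: "c \<in> {a..b}" "\<And>\<theta>. \<theta> \<in> {a..b} \<Longrightarrow> h \<theta> \<le> h c"
    using continuous_attains_sup[of "{a..b}" h] \<open>a \<le> b\<close> by auto
  have "a < b" using lo hi \<open>a \<le> b\<close> by (cases "a = b") auto
  have "c \<noteq> a"
  proof
    assume "c = a"
    obtain d where d: "d > 0" "\<And>k. 0 < k \<Longrightarrow> k < d \<Longrightarrow> h a < h (a + k)"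
      using DERIV_pos_inc_right[OF derh[of a]] lo \<open>a \<le> b\<close> by auto
    let ?k = "min (d / 2) (b - a)"
    have "h a < h (a + ?k)" using d \<open>a < b\<close> by (intro d(2)) auto
    moreover have "h (a + ?k) \<le> h a" using c(2)[of "a + ?k"] d \<open>a < b\<close> \<open>c = a\<close> by auto
    ultimately show False by simp
  qed
  moreover have "c \<noteq> b"
  proof
    assume "c = b"
    obtain d where d: "d > 0" "\<And>k. 0 < k \<Longrightarrow> k < d \<Longrightarrow> h b < h (b - k)"
      using DERIV_neg_dec_left[OF derh[of b]] hi False \<open>a \<le> b\<close> by auto
    let ?k = "min (d / 2) (b - a)"
    have "h b < h (b - ?k)" using d \<open>a < b\<close> by (intro d(2)) auto
    moreover have "h (b - ?k) \<le> h b" using c(2)[of "b - ?k"] d \<open>a < b\<close> \<open>c = b\<close> by auto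
    ultimately show False by simp
  qed
  ultimately have c': "a < c" "c < b" using c(1) by auto
  have "x - g' c = 0"
    using c c' by (intro DERIV_local_max[OF derh, of c "min (c - a) (b - c)"]) (auto simp: abs_if split: if_splits)
  then show ?thesis using c' by (intro exI[of _ c]) auto
qed

text \<open>The hypothesis \<open>c\<close> says that the Legendre transform of \<open>g\<close> at \<open>x\<close> is at most \<open>c\<close>; the conclusion
finds a slope \<open>y\<close> of \<open>g\<close> near \<open>x\<close> at which the transform, evaluated at the touching parameter, is no larger.
Start at \<open>0\<close> with a slope below \<open>x\<close> and move to the right. If the slope ever reaches \<open>x\<close>, the intermediate
value property gives \<open>y = x\<close>. Otherwise all slopes stay below \<open>x\<close>. On an unbounded half-line,
\<open>\<theta> * (x - g' \<theta>) \<le> \<theta> * x - g \<theta> \<le> c\<close> forces the slopes up to \<open>x\<close>. A finite exit point is impossible: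
by steepness the slopes would have to tend to \<open>-\<infinity>\<close> there, but the hypothesis \<open>nonneg\<close> makes \<open>g \<theta> / \<theta>\<close>
nondecreasing, and this quotient bounds the slope from below.\<close>

lemma steep_slope_approx_right:
  fixes g g' :: "real \<Rightarrow> real" and G :: "real set"
  assumes "open G" "0 \<in> G"
    and der: "\<And>\<theta>. \<theta> \<in> G \<Longrightarrow> (g has_real_derivative g' \<theta>) (at \<theta>)"
    and nonneg: "\<And>\<theta>. \<theta> \<in> G \<Longrightarrow> g \<theta> \<le> \<theta> * g' \<theta>"
    and steep: "\<And>s l. (\<And>n::nat. s n \<in> G) \<Longrightarrow> s \<longlonglongrightarrow> l \<Longrightarrow> l \<notin> G \<Longrightarrow>
                  filterlim (\<lambda>n. \<bar>g' (s n)\<bar>) at_top sequentially"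
    and c: "\<And>\<theta>. \<theta> \<in> G \<Longrightarrow> \<theta> * x - g \<theta> \<le> c"
    and "g' 0 < x" and "\<epsilon> > 0"
  shows "\<exists>\<theta>\<in>G. \<bar>g' \<theta> - x\<bar> < \<epsilon> \<and> \<theta> * g' \<theta> - g \<theta> \<le> c"
proof (cases "\<exists>b\<ge>0. {0..b} \<subseteq> G \<and> x \<le> g' b")
  case True
  then obtain b where b: "0 \<le> b" "{0..b} \<subseteq> G" "x \<le> g' b" by blast
  obtain \<theta> where "0 \<le> \<theta>" "\<theta> \<le> b" "g' \<theta> = x"
    using derivative_intermediate_value[of 0 b g g' x] der b \<open>g' 0 < x\<close>
    by (metis atLeastAtMost_iff subset_iff)
  with b c[of \<theta>] \<open>\<epsilon> > 0\<close> show ?thesis by (intro bexI[of _ \<theta>]) auto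
next
  case False
  then have below: "g' b < x" if "0 \<le> b" "{0..b} \<subseteq> G" for b using that by force
  show ?thesis
  proof (cases "{0..} \<subseteq> G")
    case True
    define \<theta> where "\<theta> = \<bar>c\<bar> / \<epsilon> + 1"
    have pos: "\<theta> > 0" using \<open>\<epsilon> > 0\<close> by (simp add: \<theta>_def add_nonneg_pos)
    have G: "\<theta> \<in> G" "{0..\<theta>} \<subseteq> G" using True pos by auto
    have lt: "g' \<theta> < x" using below G pos by auto
    have *: "\<theta> * (x - g' \<theta>) \<le> \<theta> * x - g \<theta>" using nonneg[OF G(1)] by (simp add: algebra_simps)
    also have "\<dots> \<le> \<bar>c\<bar>" using c[OF G(1)] by simp
    also have "\<dots> < \<theta> * \<epsilon>" using \<open>\<epsilon> > 0\<close> by (simp add: \<theta>_def field_simps)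
    finally have "x - g' \<theta> < \<epsilon>" using pos by simp
    moreover have "\<theta> * g' \<theta> - g \<theta> \<le> c"
      using c[OF G(1)] mult_strict_left_mono[OF lt pos] by linarith
    ultimately show ?thesis using G(1) lt by (intro bexI[of _ \<theta>]) auto
  next
    case False
    \<comment> \<open>The first exit point of the right half-line from \<open>G\<close>.\<close>
    define b where "b = Inf ({0..} - G)"
    have ne: "{0..} - G \<noteq> {}" using False by auto
    have bdd: "bdd_below ({0..} - G)" by (rule bdd_belowI[of _ 0]) auto
    have cl: "closed ({0..} - G)" using \<open>open G\<close> by (intro closed_Diff) auto
    have b: "b \<in> {0..} - G" unfolding b_def using closed_contains_Inf[OF ne bdd cl] .
    then have "b > 0" using \<open>0 \<in> G\<close> by (cases "b = 0") auto
    have inG: "\<theta> \<in> G" if "0 \<le> \<theta>" "\<theta> < b" for \<theta>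
      using that cInf_lower[OF _ bdd, of \<theta>] unfolding b_def by force
    have lt: "g' \<theta> < x" if "0 \<le> \<theta>" "\<theta> < b" for \<theta> using that inG by (intro below) auto
    define q where "q = g (b / 2) / (b / 2)"
    have lower: "q \<le> g' \<theta>" if "b / 2 \<le> \<theta>" "\<theta> < b" for \<theta>
    proof -
      have "g (b / 2) / (b / 2) \<le> g \<theta> / \<theta>"
      proof (rule DERIV_nonneg_imp_nondecreasing[of "b / 2" \<theta> "\<lambda>u. g u / u", OF that(1)])
        fix u assume u: "b / 2 \<le> u" "u \<le> \<theta>"
        have "u > 0" "u \<in> G" using u that \<open>b > 0\<close> inG[of u] by auto
        have "((\<lambda>u. g u / u) has_real_derivative (g' u * u - g u) / (u * u)) (at u)"
          using der[OF \<open>u \<in> G\<close>] \<open>u > 0\<close> by (auto intro!: derivative_eq_intros)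
        moreover have "(g' u * u - g u) / (u * u) \<ge> 0"
          using nonneg[OF \<open>u \<in> G\<close>] by (simp add: mult.commute)
        ultimately show "\<exists>y. ((\<lambda>u. g u / u) has_real_derivative y) (at u) \<and> 0 \<le> y" by blast
      qed
      also have "\<dots> \<le> g' \<theta>" using nonneg[OF inG[of \<theta>]] that \<open>b > 0\<close> by (simp add: field_simps)
      finally show ?thesis by (simp add: q_def)
    qed
    define s where "s n = b - b / (real n + 2)" for n
    have s: "b / 2 \<le> s n" "s n < b" for n
    proof -
      have "b / (real n + 2) \<le> b / 2" using \<open>b > 0\<close> by (intro divide_left_mono) auto
      then show "b / 2 \<le> s n" by (simp add: s_def)
      show "s n < b" using \<open>b > 0\<close> by (simp add: s_def add_nonneg_pos)
    qed
    have "(\<lambda>n. b / (real n + 2)) \<longlonglongrightarrow> 0"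
      using LIMSEQ_ignore_initial_segment[OF lim_const_over_n, of b 2] by (simp add: add.commute)
    then have "s \<longlonglongrightarrow> b" unfolding s_def using tendsto_diff[OF tendsto_const[of b]] by fastforce
    moreover have "s n \<in> G" for n using s[of n] \<open>b > 0\<close> by (intro inG) auto
    ultimately have "filterlim (\<lambda>n. \<bar>g' (s n)\<bar>) at_top sequentially" using b by (intro steep) auto
    then have "\<forall>\<^sub>F n in sequentially. \<bar>g' (s n)\<bar> > \<bar>q\<bar> + \<bar>x\<bar>" by (simp add: filterlim_at_top_dense)
    then obtain n where "\<bar>g' (s n)\<bar> > \<bar>q\<bar> + \<bar>x\<bar>" by (auto simp: eventually_sequentially)
    moreover have "q \<le> g' (s n)" "g' (s n) < x" using lower lt s[of n] \<open>b > 0\<close> by auto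
    ultimately show ?thesis by linarith
  qed
qed

text \<open>If the slope at \<open>0\<close> exceeds \<open>x\<close>, the previous lemma applies to the reflected function
\<open>\<theta> \<mapsto> g (- \<theta>)\<close>.\<close>

lemma steep_slope_approx:
  fixes g g' :: "real \<Rightarrow> real" and G :: "real set"
  assumes "open G" "0 \<in> G"
    and der: "\<And>\<theta>. \<theta> \<in> G \<Longrightarrow> (g has_real_derivative g' \<theta>) (at \<theta>)"
    and nonneg: "\<And>\<theta>. \<theta> \<in> G \<Longrightarrow> g \<theta> \<le> \<theta> * g' \<theta>"
    and steep: "\<And>s l. (\<And>n::nat. s n \<in> G) \<Longrightarrow> s \<longlonglongrightarrow> l \<Longrightarrow> l \<notin> G \<Longrightarrow>
                  filterlim (\<lambda>n. \<bar>g' (s n)\<bar>) at_top sequentially"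
    and c: "\<And>\<theta>. \<theta> \<in> G \<Longrightarrow> \<theta> * x - g \<theta> \<le> c"
    and "\<epsilon> > 0"
  shows "\<exists>\<theta>\<in>G. \<bar>g' \<theta> - x\<bar> < \<epsilon> \<and> \<theta> * g' \<theta> - g \<theta> \<le> c"
proof -
  consider "g' 0 = x" | "g' 0 < x" | "g' 0 > x" by linarith
  then show ?thesis
  proof cases
    case 1
    then show ?thesis using assms(2) c[of 0] \<open>\<epsilon> > 0\<close> by (intro bexI[of _ 0]) auto
  next
    case 2
    then show ?thesis using steep_slope_approx_right[of G g g' x c \<epsilon>] assms by blast
  next
    case 3
    let ?G = "uminus ` G"
    have mem: "\<theta> \<in> ?G \<longleftrightarrow> - \<theta> \<in> G" for \<theta> by force
    have "\<exists>\<theta>\<in>?G. \<bar>- g' (- \<theta>) - (- x)\<bar> < \<epsilon> \<and> \<theta> * (- g' (- \<theta>)) - g (- \<theta>) \<le> c"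
    proof (rule steep_slope_approx_right)
      show "open ?G" using \<open>open G\<close> by (rule open_negations)
      show "0 \<in> ?G" using assms(2) mem by auto
      show "((\<lambda>u. g (- u)) has_real_derivative - g' (- \<theta>)) (at \<theta>)" if "\<theta> \<in> ?G" for \<theta>
        using der[of "- \<theta>"] that mem DERIV_mirror[of g "g' (- \<theta>)" "\<theta>"] by auto
      show "g (- \<theta>) \<le> \<theta> * - g' (- \<theta>)" if "\<theta> \<in> ?G" for \<theta>
        using nonneg[of "- \<theta>"] that mem by auto
      show "filterlim (\<lambda>n. \<bar>- g' (- s n)\<bar>) at_top sequentially"
        if "\<And>n::nat. s n \<in> ?G" "s \<longlonglongrightarrow> l" "l \<notin> ?G" for s l
        using steep[of "\<lambda>n. - s n" "- l"] that mem tendsto_minus[OF that(2)] by auto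
      show "\<theta> * - x - g (- \<theta>) \<le> c" if "\<theta> \<in> ?G" for \<theta>
        using c[of "- \<theta>"] that mem by auto
      show "- g' (- 0) < - x" using 3 by simp
    qed fact
    then obtain \<theta> where "- \<theta> \<in> G" "\<bar>- g' (- \<theta>) - (- x)\<bar> < \<epsilon>" "\<theta> * (- g' (- \<theta>)) - g (- \<theta>) \<le> c"
      using mem by blast
    then show ?thesis by (intro bexI[of _ "- \<theta>"]) (auto simp: abs_minus_commute)
  qed
qed

section \<open>Chernoff bounds and exponential tilting\<close>

text \<open>Markov's inequality under the (unnormalised) measure with density \<open>exp (\<theta> * X)\<close>. With \<open>\<theta> = 0\<close> it is the
Chernoff bound behind the upper bound; with \<open>\<theta> \<noteq> 0\<close> it shows that the tilted measure concentrates, which is what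
the lower bound rests on.\<close>

lemma exp_tilted_markov:
  fixes X :: "'a \<Rightarrow> real"
  assumes [measurable]: "X \<in> borel_measurable M"
  shows "(\<integral>\<^sup>+\<omega>. ennreal (exp (\<theta> * X \<omega>)) * indicator {\<omega>\<in>space M. c \<le> h * X \<omega>} \<omega> \<partial>M)
       \<le> ennreal (exp (- c)) * (\<integral>\<^sup>+\<omega>. ennreal (exp ((\<theta> + h) * X \<omega>)) \<partial>M)"
proof -
  have "ennreal (exp (\<theta> * X \<omega>)) * indicator {\<omega>\<in>space M. c \<le> h * X \<omega>} \<omega>
      \<le> ennreal (exp (- c)) * ennreal (exp ((\<theta> + h) * X \<omega>))" for \<omega>
    by (auto simp: indicator_def algebra_simps simp flip: ennreal_mult exp_add)
  then show ?thesis
    by (subst nn_integral_cmult[symmetric]) (auto intro!: nn_integral_mono)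
qed

text \<open>The set \<open>{z. \<alpha>' < \<theta> * z - l}\<close> is an open half-line (everything or nothing if \<open>\<theta> = 0\<close>) on which the affine minorant of the rate function
belonging to \<open>\<theta>\<close> exceeds \<open>\<alpha>'\<close>. The gap between \<open>\<alpha>\<close> and \<open>\<alpha>'\<close> absorbs the error in the convergence
of the logarithmic moments.\<close>

lemma half_line_upper_bound:
  assumes W: "\<forall>t>0. W t \<in> borel_measurable M"
    and lim: "((\<lambda>t. ereal (1 / t) * log_mgf M (W t) \<theta>) \<longlongrightarrow> ereal l) at_top"
    and "\<alpha> < \<alpha>'"
  shows "\<forall>\<^sub>F t in at_top.
    emeasure M {\<omega>\<in>space M. \<alpha>' < \<theta> * (W t \<omega> / t) - l} \<le> ennreal (exp (- (t * \<alpha>)))"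
proof -
  have "\<alpha>' - \<alpha> > 0" using \<open>\<alpha> < \<alpha>'\<close> by simp
  from scaled_log_mgf_eventually_between(1)[OF lim this] eventually_gt_at_top[of 0]
  show ?thesis
  proof eventually_elim
  case (elim t)
  have [measurable]: "W t \<in> borel_measurable M" using W elim by auto
  let ?A = "{\<omega>\<in>space M. t * (\<alpha>' + l) \<le> \<theta> * W t \<omega>}"
  have "emeasure M {\<omega>\<in>space M. \<alpha>' < \<theta> * (W t \<omega> / t) - l} \<le> emeasure M ?A"
    using elim by (intro emeasure_mono) (auto simp: field_simps)
  also have "\<dots> = (\<integral>\<^sup>+\<omega>. ennreal (exp (0 * W t \<omega>)) * indicator ?A \<omega> \<partial>M)" by simp
  also have "\<dots> \<le> ennreal (exp (- (t * (\<alpha>' + l)))) * (\<integral>\<^sup>+\<omega>. ennreal (exp ((0 + \<theta>) * W t \<omega>)) \<partial>M)"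
    by (rule exp_tilted_markov) measurable
  also have "\<dots> \<le> ennreal (exp (- (t * (\<alpha>' + l)))) * ennreal (exp (t * (l + (\<alpha>' - \<alpha>))))"
    using elim \<open>\<alpha> < \<alpha>'\<close> by (intro mult_left_mono) auto
  also have "\<dots> = ennreal (exp (- (t * \<alpha>)))"
    by (simp add: algebra_simps flip: ennreal_mult exp_add)
  finally show ?case .
  qed
qed

text \<open>Tilting by \<open>exp (\<theta> * W t)\<close> moves the typical value of \<open>W t / t\<close> to the slope \<open>y\<close> of \<open>g\<close> at \<open>\<theta>\<close>:
by the tilted Markov inequality with a small step \<open>\<plusminus>h\<close>, the part of \<open>E (exp (\<theta> * W t))\<close> outside the
\<open>\<delta>\<close>-neighbourhood of \<open>y\<close> has exponential rate at most
\<open>g (\<theta> \<plusminus> h) \<mp> h * y - h * \<delta>\<close>, which differentiability makes smaller than \<open>g \<theta>\<close>. The remaining part is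
at most \<open>exp (t * (\<theta> * y + \<bar>\<theta>\<bar> * \<delta>))\<close> times the probability of the neighbourhood.\<close>

lemma tilted_lower_bound:
  fixes g :: "real \<Rightarrow> real"
  assumes "prob_space M"
    and W: "\<forall>t>0. W t \<in> borel_measurable M"
    and lim: "\<forall>\<^sub>F \<eta> in nhds \<theta>. ((\<lambda>t. ereal (1 / t) * log_mgf M (W t) \<eta>) \<longlongrightarrow> ereal (g \<eta>)) at_top"
    and der: "(g has_real_derivative y) (at \<theta>)"
    and "\<delta> > 0"
  shows "\<forall>\<^sub>F t in at_top. ennreal (exp (- (t * (\<theta> * y - g \<theta> + (\<bar>\<theta>\<bar> + 1) * \<delta>))))
           \<le> emeasure M {\<omega>\<in>space M. \<bar>W t \<omega> / t - y\<bar> < \<delta>}"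
proof -
  interpret prob_space M by fact
  obtain d where d: "d > 0" "\<And>\<eta>. dist \<eta> \<theta> < d \<Longrightarrow>
      ((\<lambda>t. ereal (1 / t) * log_mgf M (W t) \<eta>) \<longlongrightarrow> ereal (g \<eta>)) at_top"
    using lim unfolding eventually_nhds_metric by blast
  have "((\<lambda>k. (g (\<theta> + k) - g \<theta>) / k) \<longlongrightarrow> y) (at 0)" using der by (simp add: DERIV_def)
  then have "\<forall>\<^sub>F k in at 0. dist ((g (\<theta> + k) - g \<theta>) / k) y < \<delta> / 2"
    by (rule tendstoD) (use \<open>\<delta> > 0\<close> in auto)
  then obtain d' where d': "d' > 0"
    "\<And>k. k \<noteq> 0 \<Longrightarrow> \<bar>k\<bar> < d' \<Longrightarrow> \<bar>(g (\<theta> + k) - g \<theta>) / k - y\<bar> < \<delta> / 2"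
    unfolding eventually_at by (auto simp: dist_real_def)
  \<comment> \<open>The bound \<open>h \<le> 1\<close> lets the loss of a constant factor be hidden in \<open>t * \<delta>\<close> at the very end.\<close>
  define h where "h = min 1 (min d d' / 2)"
  have h: "0 < h" "h \<le> 1" "h < d" "h < d'" using d d' by (auto simp: h_def min_def)
  have "\<bar>(g (\<theta> + h) - g \<theta>) / h - y\<bar> < \<delta> / 2" using h by (intro d'(2)) auto
  then have "(g (\<theta> + h) - g \<theta>) / h < y + \<delta> / 2" by linarith
  then have up: "g (\<theta> + h) \<le> g \<theta> + h * y + h * \<delta> / 2" using h by (simp add: field_simps)
  have "\<bar>(g (\<theta> + - h) - g \<theta>) / - h - y\<bar> < \<delta> / 2" using h by (intro d'(2)) auto
  then have "(g (\<theta> - h) - g \<theta>) / - h > y - \<delta> / 2" unfolding add_uminus_conv_diff by linarith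
  then have dn: "g (\<theta> - h) \<le> g \<theta> - h * y + h * \<delta> / 2" using h by (simp add: field_simps)
  have \<epsilon>: "h * \<delta> / 8 > 0" using h \<open>\<delta> > 0\<close> by simp
  \<comment> \<open>From this time on each of the two tails carries at most a quarter of the lower bound \<open>Q\<close> for the whole.\<close>
  have "filterlim (\<lambda>t. t * (h * \<delta> / 4)) at_top at_top"
    using h \<open>\<delta> > 0\<close> by (intro filterlim_at_top_mult_tendsto_pos[OF tendsto_const _ filterlim_ident]) auto
  then have "\<forall>\<^sub>F t in at_top. ln 4 \<le> t * (h * \<delta> / 4)" by (simp add: filterlim_at_top)
  moreover note scaled_log_mgf_eventually_between(1)[OF d(2) \<epsilon>, of "\<theta> + h"]
  moreover note scaled_log_mgf_eventually_between(1)[OF d(2) \<epsilon>, of "\<theta> - h"]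
  moreover note scaled_log_mgf_eventually_between(2)[OF d(2) \<epsilon>, of \<theta>]
  ultimately have "\<forall>\<^sub>F t in at_top. t > 0 \<and> ln 4 \<le> t * (h * \<delta> / 4) \<and>
     (\<integral>\<^sup>+\<omega>. ennreal (exp ((\<theta> + h) * W t \<omega>)) \<partial>M) \<le> ennreal (exp (t * (g (\<theta> + h) + h * \<delta> / 8))) \<and>
     (\<integral>\<^sup>+\<omega>. ennreal (exp ((\<theta> - h) * W t \<omega>)) \<partial>M) \<le> ennreal (exp (t * (g (\<theta> - h) + h * \<delta> / 8))) \<and>
     ennreal (exp (t * (g \<theta> - h * \<delta> / 8))) \<le> (\<integral>\<^sup>+\<omega>. ennreal (exp (\<theta> * W t \<omega>)) \<partial>M)"
    using h d(1) eventually_gt_at_top[of "0::real"]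
    by (simp add: dist_real_def eventually_conj_iff)
  then show ?thesis
  proof eventually_elim
    case (elim t)
    then have t: "t > 0" and t4: "ln 4 \<le> t * (h * \<delta> / 4)"
      and Eup: "(\<integral>\<^sup>+\<omega>. ennreal (exp ((\<theta> + h) * W t \<omega>)) \<partial>M) \<le> ennreal (exp (t * (g (\<theta> + h) + h * \<delta> / 8)))"
      and Edn: "(\<integral>\<^sup>+\<omega>. ennreal (exp ((\<theta> - h) * W t \<omega>)) \<partial>M) \<le> ennreal (exp (t * (g (\<theta> - h) + h * \<delta> / 8)))"
      and E0: "ennreal (exp (t * (g \<theta> - h * \<delta> / 8))) \<le> (\<integral>\<^sup>+\<omega>. ennreal (exp (\<theta> * W t \<omega>)) \<partial>M)"
      by auto
    have [measurable]: "W t \<in> borel_measurable M" using W t by auto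
    define Q where "Q = exp (t * (g \<theta> - h * \<delta> / 8))"
    define R where "R = exp (t * (\<theta> * y + \<bar>\<theta>\<bar> * \<delta>))"
    have quarter: "exp (- (t * (h * \<delta> / 4))) \<le> 1 / 4"
    proof -
      have "exp (- (t * (h * \<delta> / 4))) \<le> exp (- ln (4::real))" using t4 by simp
      also have "\<dots> = 1 / 4" by (simp add: exp_minus)
      finally show ?thesis .
    qed
    let ?e = "\<lambda>\<omega>. ennreal (exp (\<theta> * W t \<omega>))"
    let ?A = "{\<omega>\<in>space M. \<bar>W t \<omega> / t - y\<bar> < \<delta>}"
    let ?U = "{\<omega>\<in>space M. t * (h * (y + \<delta>)) \<le> h * W t \<omega>}"
    let ?L = "{\<omega>\<in>space M. t * (- h * (y - \<delta>)) \<le> - h * W t \<omega>}"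
    have tail: "ennreal (exp (- (t * b))) * ennreal (exp (t * c)) \<le> ennreal (Q / 4)"
      if "c - b \<le> g \<theta> - h * \<delta> / 8 - h * \<delta> / 4" for b c
    proof -
      have "- (t * b) + t * c = t * (c - b)" by (simp add: algebra_simps)
      also have "\<dots> \<le> t * (g \<theta> - h * \<delta> / 8 - h * \<delta> / 4)"
        using that t by (intro mult_left_mono) auto
      also have "\<dots> = t * (g \<theta> - h * \<delta> / 8) + - (t * (h * \<delta> / 4))" by (simp add: algebra_simps)
      finally have "exp (- (t * b)) * exp (t * c) \<le> Q * exp (- (t * (h * \<delta> / 4)))"
        unfolding Q_def by (simp flip: exp_add)
      also have "\<dots> \<le> Q * (1 / 4)" using quarter by (intro mult_left_mono) (auto simp: Q_def)
      finally show ?thesis by (subst ennreal_mult[symmetric]) (auto intro!: ennreal_leI)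
    qed
    have IU: "(\<integral>\<^sup>+\<omega>. ?e \<omega> * indicator ?U \<omega> \<partial>M) \<le> ennreal (Q / 4)"
    proof -
      have "(\<integral>\<^sup>+\<omega>. ?e \<omega> * indicator ?U \<omega> \<partial>M)
          \<le> ennreal (exp (- (t * (h * (y + \<delta>))))) * ennreal (exp (t * (g (\<theta> + h) + h * \<delta> / 8)))"
        by (rule order_trans[OF exp_tilted_markov mult_left_mono[OF Eup]]) auto
      also have "\<dots> \<le> ennreal (Q / 4)" using up by (intro tail) (simp add: algebra_simps)
      finally show ?thesis .
    qed
    have IL: "(\<integral>\<^sup>+\<omega>. ?e \<omega> * indicator ?L \<omega> \<partial>M) \<le> ennreal (Q / 4)"
    proof -
      have "(\<integral>\<^sup>+\<omega>. ?e \<omega> * indicator ?L \<omega> \<partial>M)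
          \<le> ennreal (exp (- (t * (- h * (y - \<delta>))))) * ennreal (exp (t * (g (\<theta> - h) + h * \<delta> / 8)))"
        using exp_tilted_markov[of "W t" M \<theta> "t * (- h * (y - \<delta>))" "- h"]
        by (intro order_trans[OF _ mult_left_mono[OF Edn]]) auto
      also have "\<dots> \<le> ennreal (Q / 4)" using dn by (intro tail) (simp add: algebra_simps)
      finally show ?thesis .
    qed
    have IA: "(\<integral>\<^sup>+\<omega>. ?e \<omega> * indicator ?A \<omega> \<partial>M) \<le> ennreal (R * prob ?A)"
    proof -
      have "exp (\<theta> * W t \<omega>) \<le> R" if "\<bar>W t \<omega> / t - y\<bar> < \<delta>" for \<omega>
      proof -
        have "\<theta> * (W t \<omega> / t) - \<theta> * y \<le> \<bar>\<theta>\<bar> * \<bar>W t \<omega> / t - y\<bar>"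
          by (metis abs_ge_self abs_mult right_diff_distrib)
        also have "\<dots> \<le> \<bar>\<theta>\<bar> * \<delta>" using that by (intro mult_left_mono) auto
        finally have "t * (\<theta> * (W t \<omega> / t)) \<le> t * (\<theta> * y + \<bar>\<theta>\<bar> * \<delta>)"
          using t by (intro mult_left_mono) auto
        then show ?thesis using t by (simp add: R_def)
      qed
      then have "(\<integral>\<^sup>+\<omega>. ?e \<omega> * indicator ?A \<omega> \<partial>M) \<le> (\<integral>\<^sup>+\<omega>. ennreal R * indicator ?A \<omega> \<partial>M)"
        by (intro nn_integral_mono) (auto simp: indicator_def intro!: ennreal_leI)
      also have "\<dots> = ennreal R * emeasure M ?A" by (simp add: nn_integral_cmult_indicator)
      also have "\<dots> = ennreal (R * prob ?A)"
        by (simp add: emeasure_eq_measure ennreal_mult R_def)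
      finally show ?thesis .
    qed
    have "ennreal Q \<le> (\<integral>\<^sup>+\<omega>. ?e \<omega> \<partial>M)" using E0 by (simp add: Q_def)
    also have "\<dots> \<le> (\<integral>\<^sup>+\<omega>. (?e \<omega> * indicator ?A \<omega> + ?e \<omega> * indicator ?U \<omega>) + ?e \<omega> * indicator ?L \<omega> \<partial>M)"
    proof (intro nn_integral_mono)
      fix \<omega> assume "\<omega> \<in> space M"
      consider "\<bar>W t \<omega> / t - y\<bar> < \<delta>" | "y + \<delta> \<le> W t \<omega> / t" | "W t \<omega> / t \<le> y - \<delta>" by linarith
      then have "\<omega> \<in> ?A \<or> \<omega> \<in> ?U \<or> \<omega> \<in> ?L"
      proof cases
        case 2
        then have "h * (t * (y + \<delta>)) \<le> h * W t \<omega>" using t h by (intro mult_left_mono) (auto simp: field_simps)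
        then show ?thesis using \<open>\<omega> \<in> space M\<close> by (simp add: ac_simps)
      next
        case 3
        then have "h * W t \<omega> \<le> h * (t * (y - \<delta>))" using t h by (intro mult_left_mono) (auto simp: field_simps)
        then show ?thesis using \<open>\<omega> \<in> space M\<close> by (simp add: ac_simps)
      qed (use \<open>\<omega> \<in> space M\<close> in blast)
      then show "?e \<omega> \<le> (?e \<omega> * indicator ?A \<omega> + ?e \<omega> * indicator ?U \<omega>) + ?e \<omega> * indicator ?L \<omega>"
        by (elim disjE) (simp_all add: add_increasing add_increasing2)
    qed
    also have "\<dots> = (\<integral>\<^sup>+\<omega>. ?e \<omega> * indicator ?A \<omega> \<partial>M) + (\<integral>\<^sup>+\<omega>. ?e \<omega> * indicator ?U \<omega> \<partial>M)
        + (\<integral>\<^sup>+\<omega>. ?e \<omega> * indicator ?L \<omega> \<partial>M)"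
      by (simp add: nn_integral_add)
    also have "\<dots> \<le> ennreal (R * prob ?A) + ennreal (Q / 4) + ennreal (Q / 4)"
      by (intro add_mono IA IU IL)
    also have "\<dots> = ennreal (R * prob ?A + Q / 4 + Q / 4)"
      by (subst ennreal_plus, simp_all add: Q_def R_def del: ennreal_plus)+
    finally have "Q \<le> R * prob ?A + Q / 4 + Q / 4"
      by (subst (asm) ennreal_le_iff) (auto simp: Q_def R_def)
    then have p: "Q / 2 \<le> R * prob ?A" by simp
    have "exp (- (t * (\<theta> * y - g \<theta> + (\<bar>\<theta>\<bar> + 1) * \<delta>))) * R = exp (t * (g \<theta> - \<delta>))"
      by (simp add: R_def algebra_simps flip: exp_add)
    also have "\<dots> \<le> exp (t * (g \<theta> - h * \<delta> / 8) + - (t * (h * \<delta> / 4)))"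
    proof -
      have "h * \<delta> \<le> 1 * \<delta>" using h \<open>\<delta> > 0\<close> by (intro mult_right_mono) auto
      then have "t * (g \<theta> - \<delta>) \<le> t * (g \<theta> - h * \<delta> / 8 - h * \<delta> / 4)"
        using t \<open>\<delta> > 0\<close> by (intro mult_left_mono) auto
      then show ?thesis by (simp add: algebra_simps)
    qed
    also have "\<dots> \<le> Q * (1 / 4)" unfolding exp_add Q_def[symmetric]
      using quarter by (intro mult_left_mono) (auto simp: Q_def)
    also have "\<dots> \<le> prob ?A * R"
    proof -
      have "0 \<le> Q" by (simp add: Q_def)
      then show ?thesis using p by (simp add: mult.commute)
    qed
    finally have "exp (- (t * (\<theta> * y - g \<theta> + (\<bar>\<theta>\<bar> + 1) * \<delta>))) \<le> prob ?A"
      by (simp add: R_def)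
    then show ?case by (simp add: emeasure_eq_measure)
  qed
qed

section \<open>The Gaertner-Ellis theorem on the line\<close>

text \<open>A factor \<open>N\<close> that does not depend on \<open>t\<close> is invisible on the exponential scale. It will be the number of
half-lines in a finite cover.\<close>

lemma Limsup_scaled_elog_le:
  assumes "\<And>\<alpha>. ereal \<alpha> < r \<Longrightarrow> \<exists>N::nat. \<forall>\<^sub>F t in at_top. p t \<le> ennreal (real N * exp (- (t * \<alpha>)))"
  shows "Limsup at_top (\<lambda>t. ereal (1 / t) * elog (p t)) \<le> - r"
proof (rule ccontr)
  assume "\<not> ?thesis"
  then have "- r < Limsup at_top (\<lambda>t. ereal (1 / t) * elog (p t))" by simp
  then obtain \<beta> where \<beta>: "- r < ereal \<beta>" "ereal \<beta> < Limsup at_top (\<lambda>t. ereal (1 / t) * elog (p t))"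
    using ereal_dense2 by blast
  obtain \<gamma> where \<gamma>: "- r < ereal \<gamma>" "\<gamma> < \<beta>" using \<beta>(1) ereal_dense2 by force
  have "ereal (- \<gamma>) < r" using \<gamma>(1) by (metis ereal_minus_less_minus ereal_uminus_uminus uminus_ereal.simps(1))
  then obtain N :: nat where N: "\<forall>\<^sub>F t in at_top. p t \<le> ennreal (real N * exp (t * \<gamma>))"
    using assms[of "- \<gamma>"] by auto
  have "filterlim (\<lambda>t. t * (\<beta> - \<gamma>)) at_top at_top"
    using \<gamma>(2) by (intro filterlim_at_top_mult_tendsto_pos[OF tendsto_const _ filterlim_ident]) auto
  then have "\<forall>\<^sub>F t in at_top. ln (real N + 1) \<le> t * (\<beta> - \<gamma>)" by (simp add: filterlim_at_top)
  with N have "\<forall>\<^sub>F t in at_top. ereal (1 / t) * elog (p t) \<le> ereal \<beta>"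
    using eventually_gt_at_top[of 0]
  proof eventually_elim
    case (elim t)
    have "real N \<le> exp (ln (real N + 1))" by simp
    also have "\<dots> \<le> exp (t * (\<beta> - \<gamma>))" using elim by (simp only: exp_le_cancel_iff)
    finally have "real N * exp (t * \<gamma>) \<le> exp (t * (\<beta> - \<gamma>)) * exp (t * \<gamma>)"
      by (intro mult_right_mono) auto
    also have "\<dots> = exp (t * \<beta>)" by (simp add: algebra_simps flip: exp_add)
    finally have "p t \<le> ennreal (exp (t * \<beta>))" using elim(1) by (meson ennreal_leI order_trans)
    then show ?case using scaled_elog_le_iff elim by blast
  qed
  then have "Limsup at_top (\<lambda>t. ereal (1 / t) * elog (p t)) \<le> ereal \<beta>" by (rule Limsup_bounded)
  with \<beta>(2) show False by simp
qed

text \<open>The Gaertner-Ellis theorem on the line. The moments need to converge only where the limit is finite: a parameter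
\<open>\<theta>\<close> with \<open>\<Lambda> \<theta> = \<infinity>\<close> contributes \<open>-\<infinity>\<close> to the supremum defining \<open>I\<close>, and the tilting argument takes place
in the interior of the effective domain.

For the upper bound, a level below the infimum of \<open>I\<close> over \<open>C\<close> is exceeded at each point of \<open>C\<close> by one
affine minorant of \<open>I\<close>, hence on an open half-line; two such half-lines cover the complement of a compact
interval, and finitely many others cover the rest of \<open>C\<close>. For the lower bound, tilting handles every point that is a
slope of \<open>\<Lambda>\<close>, with a value at most \<open>I\<close>, and steepness reduces all points with finite \<open>I\<close> to slopes. The
inequality \<open>\<Lambda> \<theta> \<le> \<theta> * \<Lambda>' \<theta>\<close> that this reduction requires comes for free from the lower bound at slopes,
because probabilities are at most \<open>1\<close>.\<close>

theorem gartner_ellis_real: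
  fixes M :: "'a measure" and W :: "real \<Rightarrow> 'a \<Rightarrow> real" and \<Lambda> :: "real \<Rightarrow> ereal"
  defines "I \<equiv> \<lambda>x. SUP \<theta>. ereal (\<theta> * x) - \<Lambda> \<theta>"
  assumes "prob_space M"
    and W: "\<forall>t>0. W t \<in> borel_measurable M"
    and lim: "\<And>\<theta>. \<theta> \<in> eff_domain \<Lambda> \<Longrightarrow> ((\<lambda>t. ereal (1 / t) * log_mgf M (W t) \<theta>) \<longlongrightarrow> \<Lambda> \<theta>) at_top"
    and zero: "0 \<in> interior (eff_domain \<Lambda>)"
    and ess: "essentially_smooth \<Lambda>"
  shows "satisfies_LDP M (\<lambda>t \<omega>. W t \<omega> / t) (\<lambda>t. t) I \<and> good_rate_function I"
proof -
  interpret prob_space M by fact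
  define g where "g \<theta> = real_of_ereal (\<Lambda> \<theta>)" for \<theta>
  define D where "D = eff_domain \<Lambda>"
  have \<Lambda>_g: "\<Lambda> \<theta> = ereal (g \<theta>)" if "\<theta> \<in> D" for \<theta>
    using that ess unfolding D_def eff_domain_def essentially_smooth_def g_def
    by (cases "\<Lambda> \<theta>") auto
  have \<Lambda>_top: "\<Lambda> \<theta> = \<infinity>" if "\<theta> \<notin> D" for \<theta> using that by (simp add: D_def eff_domain_def)
  have lim_g: "((\<lambda>t. ereal (1 / t) * log_mgf M (W t) \<theta>) \<longlongrightarrow> ereal (g \<theta>)) at_top" if "\<theta> \<in> D" for \<theta>
    using lim[of \<theta>] that \<Lambda>_g[OF that] by (simp add: D_def)
  have der: "(g has_real_derivative deriv g \<theta>) (at \<theta>)" if "\<theta> \<in> interior D" for \<theta>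
    using ess that unfolding essentially_smooth_def D_def[symmetric] g_def[abs_def, symmetric]
    by (simp add: DERIV_deriv_iff_real_differentiable)

  have "g 0 = 0"
  proof -
    have "log_mgf M (W t) 0 = 0" for t by (simp add: log_mgf_def elog_def emeasure_space_1)
    then have "((\<lambda>t::real. 0) \<longlongrightarrow> ereal (g 0)) at_top"
      using lim_g[of 0] zero interior_subset by (auto simp: D_def)
    then show ?thesis using tendsto_unique[OF trivial_limit_at_top_linorder tendsto_const] by (metis ereal_eq_0(2))
  qed

  have I_ge: "ereal (\<theta> * x - g \<theta>) \<le> I x" if "\<theta> \<in> D" for \<theta> x
    unfolding I_def using \<Lambda>_g[OF that] by (intro SUP_upper2[of \<theta>]) auto
  have I_less: "\<exists>\<theta>\<in>D. \<alpha> < \<theta> * x - g \<theta>" if less: "ereal \<alpha> < I x" for \<alpha> x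
  proof -
    obtain \<theta> where \<theta>: "ereal \<alpha> < ereal (\<theta> * x) - \<Lambda> \<theta>" using less unfolding I_def less_SUP_iff by auto
    then have "\<theta> \<in> D" using \<Lambda>_top[of \<theta>] by (cases "\<theta> \<in> D") auto
    then show ?thesis using \<theta> \<Lambda>_g by auto
  qed
  have I_nonneg: "0 \<le> I x" for x
    using I_ge[of 0 x] zero interior_subset \<open>g 0 = 0\<close> by (auto simp: D_def zero_ereal_def)
  have open_above: "\<exists>U. open U \<and> x \<in> U \<and> (\<forall>z\<in>U. ereal \<alpha> < I z)" if less: "ereal \<alpha> < I x" for \<alpha> x
  proof -
    obtain \<theta> where \<theta>: "\<theta> \<in> D" "\<alpha> < \<theta> * x - g \<theta>" using I_less[OF less] by blast
    have "open {z. \<alpha> < \<theta> * z - g \<theta>}" by (intro open_Collect_less continuous_intros)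
    moreover have "ereal \<alpha> < I z" if "\<alpha> < \<theta> * z - g \<theta>" for z
      using I_ge[OF \<theta>(1), of z] that by (meson less_ereal.simps(1) less_le_trans)
    ultimately show ?thesis using \<theta>(2) by (intro exI[of _ "{z. \<alpha> < \<theta> * z - g \<theta>}"]) auto
  qed
  have rate: "rate_function I"
    unfolding rate_function_def
  proof (intro conjI allI I_nonneg)
    fix x show "I x \<le> Liminf (at x) I"
      unfolding le_Liminf_iff
    proof (intro allI impI)
      fix y assume "y < I x"
      then obtain \<alpha> where \<alpha>: "y < ereal \<alpha>" "ereal \<alpha> < I x" using ereal_dense2 by blast
      then obtain U where "open U" "x \<in> U" "\<forall>z\<in>U. ereal \<alpha> < I z" using open_above by blast
      then show "\<forall>\<^sub>F z in at x. y < I z" unfolding eventually_at_topological using \<alpha>(1)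
        by (meson less_trans)
    qed
  qed

  \<comment> \<open>Two parameters \<open>\<plusminus>h\<close> of finite moment control both tails; this gives compact level sets and exponential tightness.\<close>
  obtain h where h: "h > 0" "h \<in> D" "- h \<in> D"
  proof -
    obtain e where "e > 0" "ball 0 e \<subseteq> D"
      using zero unfolding D_def[symmetric] mem_interior by blast
    then show ?thesis by (intro that[of "e / 2"]) (auto simp: subset_iff)
  qed
  define K where "K \<alpha> = (\<bar>\<alpha>\<bar> + \<bar>g h\<bar> + \<bar>g (- h)\<bar> + 1) / h" for \<alpha>
  have tails: "\<alpha> < h * z - g h \<or> \<alpha> < - h * z - g (- h)" if "z \<notin> {- K \<alpha>..K \<alpha>}" for z \<alpha>
  proof -
    have "h * K \<alpha> < h * \<bar>z\<bar>" using that h(1) by (intro mult_strict_left_mono) auto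
    moreover have "h * K \<alpha> = \<bar>\<alpha>\<bar> + \<bar>g h\<bar> + \<bar>g (- h)\<bar> + 1" using h(1) by (simp add: K_def)
    ultimately show ?thesis by (auto simp: abs_if split: if_splits)
  qed
  have good: "good_rate_function I"
    unfolding good_rate_function_def
  proof (intro conjI rate allI impI)
    fix b :: real
    have "{x. I x \<le> ereal b} \<subseteq> {- K b..K b}"
    proof (intro subsetI, rule ccontr)
      fix x assume x: "x \<in> {x. I x \<le> ereal b}" "x \<notin> {- K b..K b}"
      then have Ix: "I x \<le> ereal b" by simp
      show False
        using order_trans[OF I_ge[OF h(2)] Ix] order_trans[OF I_ge[OF h(3)] Ix] tails[OF x(2)] by auto
    qed
    moreover have "closed {x. I x \<le> ereal b}"
    proof -
      have "open {x. ereal b < I x}"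
      proof (subst open_subopen, intro ballI)
        fix x assume "x \<in> {x. ereal b < I x}"
        then obtain U where "open U" "x \<in> U" "\<forall>z\<in>U. ereal b < I z" using open_above[of b x] by auto
        then show "\<exists>T. open T \<and> x \<in> T \<and> T \<subseteq> {x. ereal b < I x}" by (intro exI[of _ U]) auto
      qed
      moreover have "- {x. I x \<le> ereal b} = {x. ereal b < I x}" by auto
      ultimately show ?thesis by (simp add: closed_def)
    qed
    ultimately show "compact {x. I x \<le> ereal b}"
      by (meson bounded_closed_interval bounded_subset compact_eq_bounded_closed)
  qed

  have upper: "Limsup at_top (\<lambda>t. ereal (1 / t) * elog (emeasure M {\<omega>\<in>space M. W t \<omega> / t \<in> C}))
      \<le> - (INF x\<in>C. I x)" if "closed C" for C
  proof (rule Limsup_scaled_elog_le)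
    fix \<alpha> assume "ereal \<alpha> < (INF x\<in>C. I x)"
    then obtain \<alpha>' where \<alpha>': "ereal \<alpha> < ereal \<alpha>'" "ereal \<alpha>' < (INF x\<in>C. I x)" using ereal_dense2 by blast
    define A where "A \<theta> = {z. \<alpha>' < \<theta> * z - g \<theta>}" for \<theta>
    have "compact (C \<inter> {- K \<alpha>'..K \<alpha>'})" using \<open>closed C\<close> by (intro closed_Int_compact) auto
    moreover have "open (A \<theta>)" for \<theta> unfolding A_def by (intro open_Collect_less continuous_intros)
    moreover have "C \<inter> {- K \<alpha>'..K \<alpha>'} \<subseteq> (\<Union>\<theta>\<in>D. A \<theta>)"
    proof
      fix x assume "x \<in> C \<inter> {- K \<alpha>'..K \<alpha>'}"
      then have "ereal \<alpha>' < I x" using less_INF_D[OF \<alpha>'(2)] by auto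
      then show "x \<in> (\<Union>\<theta>\<in>D. A \<theta>)" using I_less by (auto simp: A_def)
    qed
    ultimately obtain F0 where F0: "F0 \<subseteq> D" "finite F0" "C \<inter> {- K \<alpha>'..K \<alpha>'} \<subseteq> (\<Union>\<theta>\<in>F0. A \<theta>)"
      by (rule compactE_image)
    define F where "F = insert h (insert (- h) F0)"
    have F: "F \<subseteq> D" "finite F" using F0 h by (auto simp: F_def)
    have cover: "\<exists>\<theta>\<in>F. \<alpha>' < \<theta> * z - g \<theta>" if "z \<in> C" for z
    proof (cases "z \<in> {- K \<alpha>'..K \<alpha>'}")
      case True
      then show ?thesis using F0(3) that unfolding F_def A_def by blast
    next
      case False
      then show ?thesis using tails[OF False] unfolding F_def by blast
    qed
    have "\<forall>\<theta>\<in>F. \<forall>\<^sub>F t in at_top.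
        emeasure M {\<omega>\<in>space M. \<alpha>' < \<theta> * (W t \<omega> / t) - g \<theta>} \<le> ennreal (exp (- (t * \<alpha>)))"
    proof
      fix \<theta> assume "\<theta> \<in> F"
      then have "\<theta> \<in> D" using F(1) by auto
      with \<alpha>'(1) show "\<forall>\<^sub>F t in at_top.
          emeasure M {\<omega>\<in>space M. \<alpha>' < \<theta> * (W t \<omega> / t) - g \<theta>} \<le> ennreal (exp (- (t * \<alpha>)))"
        by (intro half_line_upper_bound[OF W lim_g]) auto
    qed
    then have "\<forall>\<^sub>F t in at_top. \<forall>\<theta>\<in>F.
        emeasure M {\<omega>\<in>space M. \<alpha>' < \<theta> * (W t \<omega> / t) - g \<theta>} \<le> ennreal (exp (- (t * \<alpha>)))"
      using F(2) by (simp add: eventually_ball_finite_distrib)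
    then have "\<forall>\<^sub>F t in at_top. emeasure M {\<omega>\<in>space M. W t \<omega> / t \<in> C} \<le> ennreal (real (card F) * exp (- (t * \<alpha>)))"
      using eventually_gt_at_top[of 0]
    proof eventually_elim
      case (elim t)
      have [measurable]: "W t \<in> borel_measurable M" using W elim by auto
      define B where "B \<theta> = {\<omega>\<in>space M. \<alpha>' < \<theta> * (W t \<omega> / t) - g \<theta>}" for \<theta>
      have B: "B \<theta> \<in> sets M" for \<theta> unfolding B_def by measurable
      have "emeasure M {\<omega>\<in>space M. W t \<omega> / t \<in> C} \<le> emeasure M (\<Union>\<theta>\<in>F. B \<theta>)"
      proof (rule emeasure_mono)
        show "{\<omega>\<in>space M. W t \<omega> / t \<in> C} \<subseteq> (\<Union>\<theta>\<in>F. B \<theta>)" using cover unfolding B_def by blast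
        show "(\<Union>\<theta>\<in>F. B \<theta>) \<in> sets M" using F(2) B by (rule sets.finite_UN)
      qed
      also have "\<dots> \<le> (\<Sum>\<theta>\<in>F. emeasure M (B \<theta>))"
        using F(2) B by (intro emeasure_subadditive_finite) blast+
      also have "\<dots> \<le> (\<Sum>\<theta>\<in>F. ennreal (exp (- (t * \<alpha>))))"
        using elim(1) unfolding B_def by (intro sum_mono) blast
      also have "\<dots> = ennreal (real (card F) * exp (- (t * \<alpha>)))"
        by (simp add: ennreal_mult ennreal_of_nat_eq_real_of_nat)
      finally show ?case .
    qed
    then show "\<exists>N::nat. \<forall>\<^sub>F t in at_top. emeasure M {\<omega>\<in>space M. W t \<omega> / t \<in> C} \<le> ennreal (real N * exp (- (t * \<alpha>)))"
      by blast
  qed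

  have slope_lower: "\<forall>\<^sub>F t in at_top. ennreal (exp (- (t * (\<theta> * deriv g \<theta> - g \<theta> + (\<bar>\<theta>\<bar> + 1) * \<delta>))))
           \<le> emeasure M {\<omega>\<in>space M. \<bar>W t \<omega> / t - deriv g \<theta>\<bar> < \<delta>}"
    if "\<theta> \<in> interior D" "\<delta> > 0" for \<theta> \<delta>
  proof (rule tilted_lower_bound[OF \<open>prob_space M\<close> W _ der[OF that(1)] that(2)])
    show "\<forall>\<^sub>F \<eta> in nhds \<theta>. ((\<lambda>t. ereal (1 / t) * log_mgf M (W t) \<eta>) \<longlongrightarrow> ereal (g \<eta>)) at_top"
      using eventually_nhds_in_open[OF open_interior that(1)]
      by eventually_elim (use lim_g interior_subset in blast)
  qed
  have slope_nonneg: "g \<theta> \<le> \<theta> * deriv g \<theta>" if "\<theta> \<in> interior D" for \<theta>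
  proof -
    have "0 \<le> (\<theta> * deriv g \<theta> - g \<theta>) + e" if "e > 0" for e
    proof -
      define \<delta> where "\<delta> = e / (\<bar>\<theta>\<bar> + 1)"
      have \<delta>: "\<delta> > 0" "(\<bar>\<theta>\<bar> + 1) * \<delta> = e" using \<open>e > 0\<close> by (auto simp: \<delta>_def field_simps add_pos_nonneg)
      have "\<forall>\<^sub>F t in at_top. ennreal (exp (- (t * (\<theta> * deriv g \<theta> - g \<theta> + e)))) \<le> 1 \<and> t > 0"
        using slope_lower[OF \<open>\<theta> \<in> interior D\<close> \<delta>(1)] eventually_gt_at_top[of 0] unfolding \<delta>(2)
        by eventually_elim (use emeasure_le_1 order_trans in blast)
      then obtain t where "ennreal (exp (- (t * (\<theta> * deriv g \<theta> - g \<theta> + e)))) \<le> 1" "t > 0"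
        using eventually_happens'[OF trivial_limit_at_top_linorder] by blast
      then show ?thesis by (simp add: zero_le_mult_iff)
    qed
    then have "0 \<le> \<theta> * deriv g \<theta> - g \<theta>" by (rule field_le_epsilon)
    then show ?thesis by simp
  qed

  have lower: "- (INF x\<in>U. I x)
      \<le> Liminf at_top (\<lambda>t. ereal (1 / t) * elog (emeasure M {\<omega>\<in>space M. W t \<omega> / t \<in> U}))"
    if "open U" for U
  proof -
    have "- I x \<le> Liminf at_top (\<lambda>t. ereal (1 / t) * elog (emeasure M {\<omega>\<in>space M. W t \<omega> / t \<in> U}))"
      if "x \<in> U" for x
    proof (cases "I x")
      case (real c)
      have c: "\<theta> * x - g \<theta> \<le> c" if "\<theta> \<in> interior D" for \<theta>
        using I_ge[of \<theta> x] that interior_subset real by auto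
      obtain \<epsilon>U where \<epsilon>U: "\<epsilon>U > 0" "ball x \<epsilon>U \<subseteq> U"
        using \<open>open U\<close> \<open>x \<in> U\<close> open_contains_ball by blast
      have "ereal (- c) \<le> Liminf at_top (\<lambda>t. ereal (1 / t) * elog (emeasure M {\<omega>\<in>space M. W t \<omega> / t \<in> U})) + ereal e"
        if "e > 0" for e
      proof -
        \<comment> \<open>The point \<open>x\<close> may lie at the edge of the set of slopes; nearby slopes do not cost more than \<open>c\<close>.\<close>
        have "\<exists>\<theta>\<in>interior D. \<bar>deriv g \<theta> - x\<bar> < \<epsilon>U / 2 \<and> \<theta> * deriv g \<theta> - g \<theta> \<le> c"
        proof (rule steep_slope_approx[OF open_interior _ der slope_nonneg _ c])
          show "0 \<in> interior D" using zero by (simp add: D_def)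
          show "filterlim (\<lambda>n. \<bar>deriv g (s n)\<bar>) at_top sequentially"
            if s: "\<And>n::nat. s n \<in> interior D" "s \<longlonglongrightarrow> l" "l \<notin> interior D" for s l
          proof -
            have "l \<in> closure D"
              using s(1,2) interior_subset closure_sequential by blast
            then have "l \<in> frontier D" using s(3) by (simp add: frontier_def)
            then show ?thesis using ess s(1,2)
              unfolding essentially_smooth_def D_def[symmetric] g_def[abs_def, symmetric] by blast
          qed
          show "\<epsilon>U / 2 > 0" using \<epsilon>U by simp
        qed
        then obtain \<theta> where \<theta>: "\<theta> \<in> interior D" "\<bar>deriv g \<theta> - x\<bar> < \<epsilon>U / 2" "\<theta> * deriv g \<theta> - g \<theta> \<le> c" by blast
        define \<delta> where "\<delta> = min (\<epsilon>U / 2) (e / (\<bar>\<theta>\<bar> + 1))"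
        have pos: "\<bar>\<theta>\<bar> + 1 > 0" by simp
        have \<delta>: "\<delta> > 0" using \<epsilon>U \<open>e > 0\<close> pos by (simp add: \<delta>_def)
        have "(\<bar>\<theta>\<bar> + 1) * \<delta> \<le> (\<bar>\<theta>\<bar> + 1) * (e / (\<bar>\<theta>\<bar> + 1))"
          unfolding \<delta>_def by (intro mult_left_mono) auto
        then have \<delta>e: "(\<bar>\<theta>\<bar> + 1) * \<delta> \<le> e" using pos by simp
        have "\<forall>\<^sub>F t in at_top. ereal (- c - e)
            \<le> ereal (1 / t) * elog (emeasure M {\<omega>\<in>space M. W t \<omega> / t \<in> U})"
          using slope_lower[OF \<theta>(1) \<delta>] eventually_gt_at_top[of 0]
        proof eventually_elim
          case (elim t)
          have [measurable]: "W t \<in> borel_measurable M" "U \<in> sets borel" using W elim \<open>open U\<close> by auto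
          have "t * (- c - e) \<le> t * - (\<theta> * deriv g \<theta> - g \<theta> + (\<bar>\<theta>\<bar> + 1) * \<delta>)"
            using elim \<theta>(3) \<delta>e by (intro mult_left_mono) auto
          then have "ennreal (exp (t * (- c - e)))
              \<le> ennreal (exp (- (t * (\<theta> * deriv g \<theta> - g \<theta> + (\<bar>\<theta>\<bar> + 1) * \<delta>))))"
            by (intro ennreal_leI) (simp only: exp_le_cancel_iff mult_minus_right)
          also have "\<dots> \<le> emeasure M {\<omega>\<in>space M. \<bar>W t \<omega> / t - deriv g \<theta>\<bar> < \<delta>}" using elim by blast
          also have "\<dots> \<le> emeasure M {\<omega>\<in>space M. W t \<omega> / t \<in> U}"
          proof (intro emeasure_mono subsetI)
            fix \<omega> assume "\<omega> \<in> {\<omega>\<in>space M. \<bar>W t \<omega> / t - deriv g \<theta>\<bar> < \<delta>}"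
            then have "\<omega> \<in> space M" "\<bar>W t \<omega> / t - deriv g \<theta>\<bar> < \<epsilon>U / 2" by (auto simp: \<delta>_def)
            then have "\<bar>x - W t \<omega> / t\<bar> < \<epsilon>U" using \<theta>(2) by linarith
            then show "\<omega> \<in> {\<omega>\<in>space M. W t \<omega> / t \<in> U}"
              using \<epsilon>U(2) \<open>\<omega> \<in> space M\<close> by (auto simp: dist_real_def)
          qed measurable
          finally show ?case by (simp add: le_scaled_elog_iff[OF elim(2)])
        qed
        then have "ereal (- c - e) \<le> Liminf at_top (\<lambda>t. ereal (1 / t) * elog (emeasure M {\<omega>\<in>space M. W t \<omega> / t \<in> U}))"
          by (rule Liminf_bounded)
        then have "ereal (- c - e) + ereal e \<le> Liminf at_top (\<lambda>t. ereal (1 / t) * elog (emeasure M {\<omega>\<in>space M. W t \<omega> / t \<in> U})) + ereal e"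
          by (intro add_right_mono)
        then show ?thesis by simp
      qed
      then have "ereal (- c) \<le> Liminf at_top (\<lambda>t. ereal (1 / t) * elog (emeasure M {\<omega>\<in>space M. W t \<omega> / t \<in> U}))"
        by (rule ereal_le_epsilon2)
      then show ?thesis using real by simp
    qed (use I_nonneg[of x] in auto)
    then show ?thesis unfolding ereal_SUP_uminus_eq[symmetric] by (rule SUP_least)
  qed

  have Wt: "(\<lambda>\<omega>. W t \<omega> / t) \<in> borel_measurable M" if "t > 0" for t
  proof -
    have [measurable]: "W t \<in> borel_measurable M" using W \<open>t > 0\<close> by blast
    show ?thesis by measurable
  qed
  have "satisfies_LDP M (\<lambda>t \<omega>. W t \<omega> / t) (\<lambda>t. t) I"
    unfolding satisfies_LDP_def
  proof (intro conjI allI impI)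
    show "prob_space M" by fact
    show "rate_function I" by (rule rate)
    show "LIM t at_top. (t::real) :> at_top" by (rule filterlim_ident)
  qed (fact Wt upper lower)+
  then show ?thesis using good by blast
qed

section \<open>Exponential moments of a Levy process\<close>

text \<open>Additivity gives \<open>\<psi> q = q * \<psi> 1 = 0\<close> at rational \<open>q\<close>. A value at \<open>s\<close> is also taken at \<open>s - q\<close>, which can be made
smaller than \<open>\<delta> / N\<close>; multiplying by \<open>N\<close> and using the bound shows \<open>\<psi> s \<ge> - B / N\<close> for all \<open>N\<close>. So \<open>\<psi>\<close> is
nonnegative, hence monotone, and vanishes by comparison with rational points.\<close>

lemma additive_bounded_below_imp_zero:
  fixes \<psi> :: "real \<Rightarrow> real"
  assumes add: "\<And>s t. 0 < s \<Longrightarrow> 0 < t \<Longrightarrow> \<psi> (s + t) = \<psi> s + \<psi> t"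
    and one: "\<psi> 1 = 0"
    and "\<delta> > 0" and bound: "\<And>s. 0 < s \<Longrightarrow> s \<le> \<delta> \<Longrightarrow> - B \<le> \<psi> s"
    and "s > 0"
  shows "\<psi> s = 0"
proof -
  have mult: "\<psi> (real (Suc n) * u) = real (Suc n) * \<psi> u" if "u > 0" for n u
  proof (induction n)
    case (Suc n)
    have "real (Suc (Suc n)) * u = real (Suc n) * u + u" by (simp add: algebra_simps)
    then show ?case using add[of "real (Suc n) * u" u] Suc that
      by (simp add: ring_distribs add_pos_nonneg del: of_nat_Suc) (simp add: algebra_simps)
  qed simp
  have rat: "\<psi> q = 0" if q: "q \<in> \<rat>" "q > 0" for q
  proof -
    obtain m n where mn: "n \<noteq> 0" "\<bar>q\<bar> = real m / real n" using Rats_abs_nat_div_natE[OF q(1)] by metis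
    then obtain m' n' where mn': "m = Suc m'" "n = Suc n'" using q(2) by (cases m; cases n) auto
    have "real (Suc n') * q = real (Suc m') * 1" using mn q(2) unfolding mn' by (simp add: field_simps)
    then have "real (Suc n') * \<psi> q = real (Suc m') * \<psi> 1" using mult q(2) by (metis zero_less_one)
    then show ?thesis using one by simp
  qed
  have nonneg: "0 \<le> \<psi> u" if "u > 0" for u
  proof (rule ccontr)
    assume "\<not> 0 \<le> \<psi> u"
    then obtain N where "B < real N * - \<psi> u" using ex_less_of_nat_mult[of "- \<psi> u" B] by auto
    also have "\<dots> \<le> real (Suc N) * - \<psi> u" using \<open>\<not> 0 \<le> \<psi> u\<close> by (intro mult_right_mono) auto
    finally have N: "B < real (Suc N) * - \<psi> u" .
    have "max 0 (u - \<delta> / real (Suc N)) < u" using \<open>u > 0\<close> \<open>\<delta> > 0\<close> by simp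
    then obtain q where q: "q \<in> \<rat>" "max 0 (u - \<delta> / real (Suc N)) < q" "q < u" using Rats_dense_in_real by blast
    have "\<psi> u = \<psi> (u - q)" using add[of q "u - q"] rat[of q] q by simp
    then have "real (Suc N) * \<psi> u = \<psi> (real (Suc N) * (u - q))" using mult[of "u - q"] q(3) by simp
    also have "\<dots> \<ge> - B"
    proof (rule bound)
      have "u - q \<le> \<delta> / real (Suc N)" using q(2) by simp
      then show "real (Suc N) * (u - q) \<le> \<delta>" by (simp add: field_simps)
    qed (use q(3) in simp)
    finally show False using N by simp
  qed
  obtain q where q: "q \<in> \<rat>" "s < q" using Rats_dense_in_real[of s "s + 1"] by auto
  have "0 = \<psi> s + \<psi> (q - s)" using add[of s "q - s"] rat[of q] q \<open>s > 0\<close> by simp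
  then show ?thesis using nonneg[of s] nonneg[of "q - s"] q \<open>s > 0\<close> by simp
qed

lemma (in prob_space) nn_integral_exp_nonzero:
  assumes [measurable]: "X \<in> borel_measurable M"
  shows "(\<integral>\<^sup>+\<omega>. ennreal (exp (\<theta> * X \<omega>)) \<partial>M) \<noteq> 0"
proof
  assume "(\<integral>\<^sup>+\<omega>. ennreal (exp (\<theta> * X \<omega>)) \<partial>M) = 0"
  then have "AE \<omega> in M. ennreal (exp (\<theta> * X \<omega>)) = 0" by (subst (asm) nn_integral_0_iff_AE) auto
  then have "AE \<omega> in M. False" by eventually_elim simp
  then show False by simp
qed

text \<open>The increments over \<open>[0, s]\<close> and \<open>[s, s + t]\<close> are independent, and the second one is distributed like \<open>S t\<close>.
Working in \<^typ>\<open>ennreal\<close> gives the identity before any moment is known to be finite.\<close>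

lemma levy_process_mgf_mult:
  assumes levy: "levy_process M S" and "s > 0" "t > 0"
  shows "(\<integral>\<^sup>+\<omega>. ennreal (exp (\<theta> * S (s + t) \<omega>)) \<partial>M)
       = (\<integral>\<^sup>+\<omega>. ennreal (exp (\<theta> * S s \<omega>)) \<partial>M) * (\<integral>\<^sup>+\<omega>. ennreal (exp (\<theta> * S t \<omega>)) \<partial>M)"
proof -
  interpret prob_space M using levy by (simp add: levy_process_def)
  have meas: "S u \<in> borel_measurable M" if "u \<ge> 0" for u
    using levy that by (simp add: levy_process_def)
  have [measurable]: "S 0 \<in> borel_measurable M" "S s \<in> borel_measurable M" "S t \<in> borel_measurable M" "S (s + t) \<in> borel_measurable M"
    using assms(2,3) by (auto intro!: meas)
  have S0: "AE \<omega> in M. S 0 \<omega> = 0" using levy by (simp add: levy_process_def)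
  define \<tau> where "\<tau> i = (if i = 0 then 0 else if i = Suc 0 then s else s + t)" for i :: nat
  have "indep_vars (\<lambda>_. borel) (\<lambda>i \<omega>. S (\<tau> (Suc i)) \<omega> - S (\<tau> i) \<omega>) {..<2}"
  proof -
    have "0 \<le> \<tau> 0 \<and> (\<forall>i<2. \<tau> i < \<tau> (Suc i))"
      using assms(2,3) by (auto simp: \<tau>_def)
    then show ?thesis using levy unfolding levy_process_def by blast
  qed
  then have ind: "indep_vars (\<lambda>_. borel) (\<lambda>i \<omega>. ennreal (exp (\<theta> * (S (\<tau> (Suc i)) \<omega> - S (\<tau> i) \<omega>)))) {..<2}"
    by (rule indep_vars_compose2) simp
  have stat: "distr M borel (\<lambda>\<omega>. S (s + t) \<omega> - S s \<omega>) = distr M borel (S t)"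
    using levy assms(2,3) by (simp add: levy_process_def)
  have "(\<integral>\<^sup>+\<omega>. ennreal (exp (\<theta> * S (s + t) \<omega>)) \<partial>M)
      = (\<integral>\<^sup>+\<omega>. (\<Prod>i<2. ennreal (exp (\<theta> * (S (\<tau> (Suc i)) \<omega> - S (\<tau> i) \<omega>)))) \<partial>M)"
    using S0 by (intro nn_integral_cong_AE)
      (auto simp: \<tau>_def numeral_2_eq_2 lessThan_Suc algebra_simps simp flip: ennreal_mult exp_add)
  also have "\<dots> = (\<Prod>i<2. \<integral>\<^sup>+\<omega>. ennreal (exp (\<theta> * (S (\<tau> (Suc i)) \<omega> - S (\<tau> i) \<omega>))) \<partial>M)"
    by (rule indep_vars_nn_integral[OF _ ind]) auto
  also have "\<dots> = (\<integral>\<^sup>+\<omega>. ennreal (exp (\<theta> * (S s \<omega> - S 0 \<omega>))) \<partial>M) * (\<integral>\<^sup>+\<omega>. ennreal (exp (\<theta> * (S (s + t) \<omega> - S s \<omega>))) \<partial>M)"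
    by (simp add: \<tau>_def numeral_2_eq_2 lessThan_Suc mult.commute)
  also have "(\<integral>\<^sup>+\<omega>. ennreal (exp (\<theta> * (S s \<omega> - S 0 \<omega>))) \<partial>M) = (\<integral>\<^sup>+\<omega>. ennreal (exp (\<theta> * S s \<omega>)) \<partial>M)"
    using S0 by (intro nn_integral_cong_AE) auto
  also have "(\<integral>\<^sup>+\<omega>. ennreal (exp (\<theta> * (S (s + t) \<omega> - S s \<omega>))) \<partial>M)
      = (\<integral>\<^sup>+x. ennreal (exp (\<theta> * x)) \<partial>distr M borel (\<lambda>\<omega>. S (s + t) \<omega> - S s \<omega>))"
    by (subst nn_integral_distr) auto
  also have "\<dots> = (\<integral>\<^sup>+\<omega>. ennreal (exp (\<theta> * S t \<omega>)) \<partial>M)"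
    unfolding stat by (subst nn_integral_distr) auto
  finally show ?thesis .
qed

text \<open>The regularity in time that excludes pathological solutions of the multiplicative functional equation: by stochastic
continuity at \<open>0\<close>, \<open>\<bar>S s\<bar> \<le> 1\<close> has probability at least one half for small \<open>s\<close>.\<close>

lemma levy_process_mgf_bounded_below_near_zero:
  assumes levy: "levy_process M S"
  shows "\<exists>\<delta>>0. \<exists>c>0. \<forall>s. 0 < s \<longrightarrow> s \<le> \<delta> \<longrightarrow> ennreal c \<le> (\<integral>\<^sup>+\<omega>. ennreal (exp (\<theta> * S s \<omega>)) \<partial>M)"
proof -
  interpret prob_space M using levy by (simp add: levy_process_def)
  have "((\<lambda>u. prob {\<omega> \<in> space M. \<bar>S u \<omega> - S 0 \<omega>\<bar> > 1}) \<longlongrightarrow> 0) (at 0 within {0..})"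
    using levy by (simp add: levy_process_def)
  then have "\<forall>\<^sub>F u in at 0 within {0..}. prob {\<omega> \<in> space M. \<bar>S u \<omega> - S 0 \<omega>\<bar> > 1} < 1 / 2"
    by (rule order_tendstoD(2)) simp
  then obtain d where d: "d > 0"
    "\<And>u. 0 < u \<Longrightarrow> u < d \<Longrightarrow> prob {\<omega> \<in> space M. \<bar>S u \<omega> - S 0 \<omega>\<bar> > 1} < 1 / 2"
    unfolding eventually_at by (auto simp: dist_real_def)
  have S0: "AE \<omega> in M. S 0 \<omega> = 0" using levy by (simp add: levy_process_def)
  have "ennreal (exp (- \<bar>\<theta>\<bar>) / 2) \<le> (\<integral>\<^sup>+\<omega>. ennreal (exp (\<theta> * S s \<omega>)) \<partial>M)" if "0 < s" "s \<le> d / 2" for s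
  proof -
    have [measurable]: "S s \<in> borel_measurable M" "S 0 \<in> borel_measurable M"
      using levy that by (auto simp: levy_process_def)
    let ?A = "{\<omega> \<in> space M. \<bar>S s \<omega> - S 0 \<omega>\<bar> > 1}"
    have "prob (space M - ?A) = 1 - prob ?A" by (rule prob_compl) measurable
    then have half: "1 / 2 \<le> prob (space M - ?A)" using d(2)[of s] d(1) that by simp
    have "ennreal (exp (- \<bar>\<theta>\<bar>) / 2) \<le> ennreal (exp (- \<bar>\<theta>\<bar>) * prob (space M - ?A))"
      using half by (intro ennreal_leI) simp
    also have "\<dots> = (\<integral>\<^sup>+\<omega>. ennreal (exp (- \<bar>\<theta>\<bar>)) * indicator (space M - ?A) \<omega> \<partial>M)"
      by (subst nn_integral_cmult_indicator) (auto simp: emeasure_eq_measure ennreal_mult)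
    also have "\<dots> \<le> (\<integral>\<^sup>+\<omega>. ennreal (exp (\<theta> * S s \<omega>)) \<partial>M)"
    proof (rule nn_integral_mono_AE)
      show "AE \<omega> in M. ennreal (exp (- \<bar>\<theta>\<bar>)) * indicator (space M - ?A) \<omega> \<le> ennreal (exp (\<theta> * S s \<omega>))"
        using S0
      proof eventually_elim
        case (elim \<omega>)
        have "- \<bar>\<theta>\<bar> \<le> \<theta> * S s \<omega>" if "\<bar>S s \<omega>\<bar> \<le> 1"
        proof -
          have "\<bar>\<theta> * S s \<omega>\<bar> \<le> \<bar>\<theta>\<bar> * 1" unfolding abs_mult using that by (intro mult_left_mono) auto
          then show ?thesis by linarith
        qed
        then show ?case using elim by (auto simp: indicator_def intro!: ennreal_leI)
      qed
    qed
    finally show ?thesis .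
  qed
  then show ?thesis using d(1) by (intro exI[of _ "d / 2"] conjI exI[of _ "exp (- \<bar>\<theta>\<bar>) / 2"]) auto
qed

text \<open>\<open>E (exp (\<theta> * S s))\<close> is multiplicative in \<open>s\<close> and equals \<open>exp k\<close> at \<open>s = 1\<close>. Finiteness at all integers
follows by multiplication, and then at all times, because an infinite factor would make a later integer time infinite. The
logarithm minus \<open>k * s\<close> is additive, bounded below near \<open>0\<close> and zero at \<open>1\<close>.\<close>

lemma levy_process_mgf:
  assumes levy: "levy_process M S" and kappa: "kappa M S \<theta> = ereal k" and "s \<ge> 0"
  shows "(\<integral>\<^sup>+\<omega>. ennreal (exp (\<theta> * S s \<omega>)) \<partial>M) = ennreal (exp (k * s))"
proof -
  interpret prob_space M using levy by (simp add: levy_process_def)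
  define \<phi> where "\<phi> u = (\<integral>\<^sup>+\<omega>. ennreal (exp (\<theta> * S u \<omega>)) \<partial>M)" for u
  have one: "\<phi> 1 = ennreal (exp k)"
    using kappa by (simp add: kappa_def log_mgf_def elog_eq_ereal_iff \<phi>_def)
  have mult: "\<phi> (u + v) = \<phi> u * \<phi> v" if "u > 0" "v > 0" for u v
    unfolding \<phi>_def by (rule levy_process_mgf_mult[OF levy that])
  have nz: "\<phi> u \<noteq> 0" if "u > 0" for u
    unfolding \<phi>_def using levy that by (intro nn_integral_exp_nonzero) (auto simp: levy_process_def)
  have nat: "\<phi> (real (Suc n)) < top" for n
  proof (induction n)
    case 0 then show ?case using one by simp
  next
    case (Suc n)
    then show ?case using mult[of "real (Suc n)" 1] one
      by (simp add: ennreal_mult_less_top add.commute)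
  qed
  have fin: "\<phi> u < top" if "u > 0" for u
  proof (rule ccontr)
    assume "\<not> \<phi> u < top"
    then have "\<phi> u = top" by (simp add: less_top[symmetric])
    obtain n where n: "u < real n" using reals_Archimedean2 by blast
    have "\<phi> (real (Suc n)) = \<phi> u * \<phi> (real (Suc n) - u)" using mult[of u "real (Suc n) - u"] that n by simp
    also have "\<dots> = top" using \<open>\<phi> u = top\<close> nz[of "real (Suc n) - u"] n by (simp add: ennreal_top_mult)
    finally show False using nat[of n] by simp
  qed
  have pos: "0 < enn2real (\<phi> u)" if "u > 0" for u
    using nz[OF that] fin[OF that] by (simp add: enn2real_positive_iff zero_less_iff_neq_zero)
  define \<psi> where "\<psi> u = ln (enn2real (\<phi> u)) - k * u" for u
  obtain \<delta> c where \<delta>c: "\<delta> > 0" "c > 0" "\<And>u. 0 < u \<Longrightarrow> u \<le> \<delta> \<Longrightarrow> ennreal c \<le> \<phi> u"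
    using levy_process_mgf_bounded_below_near_zero[OF levy, of \<theta>] unfolding \<phi>_def by blast
  have zero: "\<psi> u = 0" if "u > 0" for u
  proof (rule additive_bounded_below_imp_zero[of \<psi> \<delta> "\<bar>k\<bar> * \<delta> - ln c"])
    show "\<psi> (u + v) = \<psi> u + \<psi> v" if "u > 0" "v > 0" for u v
      using pos[OF that(1)] pos[OF that(2)] mult[OF that]
      by (simp add: \<psi>_def enn2real_mult ln_mult algebra_simps)
    show "\<psi> 1 = 0" using one by (simp add: \<psi>_def)
    show "- (\<bar>k\<bar> * \<delta> - ln c) \<le> \<psi> u" if "0 < u" "u \<le> \<delta>" for u
    proof -
      have "c \<le> enn2real (\<phi> u)" using \<delta>c(3)[OF that] fin[OF that(1)] \<delta>c(2)
        by (metis enn2real_ennreal enn2real_mono less_imp_le)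
      then have "ln c \<le> ln (enn2real (\<phi> u))" using \<delta>c(2) by simp
      moreover have "k * u \<le> \<bar>k\<bar> * \<delta>" using that by (intro mult_mono) auto
      ultimately show ?thesis by (simp add: \<psi>_def)
    qed
  qed (use \<delta>c that in auto)
  show ?thesis
  proof (cases "s = 0")
    case True
    have "(\<integral>\<^sup>+\<omega>. ennreal (exp (\<theta> * S 0 \<omega>)) \<partial>M) = (\<integral>\<^sup>+\<omega>. 1 \<partial>M)"
      using levy by (intro nn_integral_cong_AE) (auto simp: levy_process_def)
    then show ?thesis using True by (simp add: emeasure_space_1)
  next
    case False
    then have "s > 0" using \<open>s \<ge> 0\<close> by simp
    then have "exp (ln (enn2real (\<phi> s))) = exp (k * s)" using zero[of s] by (simp add: \<psi>_def)
    then have "enn2real (\<phi> s) = exp (k * s)" using pos[OF \<open>s > 0\<close>] by simp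
    then show ?thesis using fin[OF \<open>s > 0\<close>] unfolding \<phi>_def by (metis ennreal_enn2real)
  qed
qed

section \<open>Independent random times\<close>

text \<open>Conditioning on the time \<open>L t\<close>. Independence speaks of the product \<open>\<sigma>\<close>-algebra on paths, for which
evaluation \<open>(p, s) \<mapsto> p s\<close> is not measurable. The functional \<open>F\<close> in the proof evaluates \<open>p\<close> along grid points that decrease to
\<open>s\<close>; it is measurable as a limit of functions that read only countably many coordinates, and it agrees with evaluation on
right-continuous paths. Tonelli's theorem for the product law then finishes the argument.\<close>

lemma nn_integral_independent_time_change:
  fixes S L :: "real \<Rightarrow> 'a \<Rightarrow> real" and h :: "real \<Rightarrow> ennreal"
  assumes "prob_space M"
    and right_cont: "AE \<omega> in M. \<forall>s\<ge>0. ((\<lambda>u. S u \<omega>) \<longlongrightarrow> S s \<omega>) (at_right s)"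
    and indep: "indep_processes M S L"
    and "t \<ge> 0" and L: "AE \<omega> in M. 0 \<le> L t \<omega>"
    and [measurable]: "h \<in> borel_measurable borel"
  shows "(\<integral>\<^sup>+\<omega>. h (S (L t \<omega>) \<omega>) \<partial>M) = (\<integral>\<^sup>+\<omega>. \<integral>\<^sup>+\<omega>'. h (S (L t \<omega>) \<omega>') \<partial>M \<partial>M)"
proof -
  interpret prob_space M by fact
  define P where "P = Pi\<^sub>M {0::real..} (\<lambda>_. borel :: real measure)"
  define X where "X \<omega> = (\<lambda>t\<in>{0..}. S t \<omega>)" for \<omega>
  have comp: "(\<lambda>p. p u) \<in> borel_measurable P" if "u \<ge> 0" for u
    unfolding P_def using that by (intro measurable_component_singleton) auto
  \<comment> \<open>The least multiple of \<open>1 / Suc n\<close> strictly above \<open>s\<close>; strictness matters because right limits ignore the value at \<open>s\<close>.\<close>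
  define r where "r n s = (real (nat \<lfloor>real (Suc n) * s\<rfloor>) + 1) / real (Suc n)" for n s
  define F where "F p s = lim (\<lambda>n. p (r n s) :: real)" for p s
  have F_meas[measurable]: "(\<lambda>x. F (fst x) (snd x)) \<in> borel_measurable (P \<Otimes>\<^sub>M borel)"
    unfolding F_def
  proof (rule borel_measurable_lim_metric)
    fix n
    show "(\<lambda>x. fst x (r n (snd x))) \<in> borel_measurable (P \<Otimes>\<^sub>M borel)"
      unfolding r_def
    proof (rule measurable_compose_countable[where f = "\<lambda>i x. fst x ((real i + 1) / real (Suc n))"
          and g = "\<lambda>x. nat \<lfloor>real (Suc n) * snd x\<rfloor>"])
      fix i :: nat
      show "(\<lambda>x. fst x ((real i + 1) / real (Suc n))) \<in> borel_measurable (P \<Otimes>\<^sub>M borel)"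
        by (rule measurable_compose[OF measurable_fst comp]) auto
    qed measurable
  qed
  have r: "filterlim (\<lambda>n. r n s) (at_right s) sequentially" if "s \<ge> 0" for s
  proof -
    have eq: "real (nat \<lfloor>real (Suc n) * s\<rfloor>) = of_int \<lfloor>real (Suc n) * s\<rfloor>" for n using that by simp
    have gt: "s < r n s" for n
    proof -
      have "real (Suc n) * s < of_int \<lfloor>real (Suc n) * s\<rfloor> + 1" by linarith
      then show ?thesis unfolding r_def eq by (simp add: field_simps)
    qed
    have le: "r n s \<le> s + 1 / real (Suc n)" for n
    proof -
      have "of_int \<lfloor>real (Suc n) * s\<rfloor> + 1 \<le> real (Suc n) * s + 1" by linarith
      then have "r n s \<le> (real (Suc n) * s + 1) / real (Suc n)"
        unfolding r_def eq by (rule divide_right_mono) simp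
      also have "\<dots> = s + 1 / real (Suc n)" by (simp add: add_divide_distrib del: of_nat_Suc)
      finally show ?thesis .
    qed
    have "(\<lambda>n. s + 1 / real (Suc n)) \<longlonglongrightarrow> s"
      using tendsto_add[OF tendsto_const[of s] LIMSEQ_Suc[OF lim_1_over_n]] by simp
    then have "(\<lambda>n. r n s) \<longlonglongrightarrow> s"
      by (rule tendsto_sandwich[OF always_eventually[OF allI[OF less_imp_le[OF gt]]]
            always_eventually[OF allI[OF le]] tendsto_const])
    then show ?thesis using gt by (intro tendsto_imp_filterlim_at_right) auto
  qed
  have F_eq: "AE \<omega> in M. \<forall>s\<ge>0. F (X \<omega>) s = S s \<omega>"
    using right_cont
  proof eventually_elim
    case (elim \<omega>)
    show ?case
    proof (intro allI impI)
      fix s :: real assume s: "s \<ge> 0"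
      have "(\<lambda>n. S (r n s) \<omega>) \<longlonglongrightarrow> S s \<omega>" using filterlim_compose[OF _ r[OF s]] elim s by blast
      moreover have "X \<omega> (r n s) = S (r n s) \<omega>" for n by (simp add: X_def r_def)
      ultimately show "F (X \<omega>) s = S s \<omega>" unfolding F_def by (simp add: limI)
    qed
  qed
  define Y where "Y \<omega> = (\<lambda>t\<in>{0..}. L t \<omega>)" for \<omega>
  have Y_t: "Y \<omega> t = L t \<omega>" for \<omega> using \<open>t \<ge> 0\<close> by (simp add: Y_def)
  have ind: "indep_var P X P Y"
    using indep unfolding indep_processes_def P_def X_def[abs_def] Y_def[abs_def] .
  have [measurable]: "X \<in> measurable M P" "Y \<in> measurable M P"
    using indep_var_rv1[OF ind] indep_var_rv2[OF ind] by auto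
  have prod: "distr M P X \<Otimes>\<^sub>M distr M P Y = distr M (P \<Otimes>\<^sub>M P) (\<lambda>\<omega>. (X \<omega>, Y \<omega>))"
    using ind by (simp add: indep_var_distribution_eq)
  interpret X: prob_space "distr M P X" by (rule prob_space_distr) measurable
  interpret Y: prob_space "distr M P Y" by (rule prob_space_distr) measurable
  interpret XY: pair_prob_space "distr M P X" "distr M P Y" ..
  have hF: "(\<lambda>x. h (F (fst x) (snd x))) \<in> borel_measurable (P \<Otimes>\<^sub>M borel)" by measurable
  have "(\<lambda>x. (fst x, snd x t)) \<in> measurable (P \<Otimes>\<^sub>M P) (P \<Otimes>\<^sub>M borel)"
    by (intro measurable_Pair measurable_fst measurable_compose[OF measurable_snd comp] \<open>t \<ge> 0\<close>)
  from measurable_compose[OF this hF]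
  have hFt: "(\<lambda>x. h (F (fst x) (snd x t))) \<in> borel_measurable (P \<Otimes>\<^sub>M P)" by simp
  then have hFt': "(\<lambda>x. h (F (fst x) (snd x t))) \<in> borel_measurable (distr M P X \<Otimes>\<^sub>M distr M P Y)"
    by (simp cong: measurable_cong_sets sets_pair_measure_cong)
  have "(\<integral>\<^sup>+\<omega>. h (S (L t \<omega>) \<omega>) \<partial>M) = (\<integral>\<^sup>+\<omega>. h (F (X \<omega>) (Y \<omega> t)) \<partial>M)"
  proof (rule nn_integral_cong_AE)
    show "AE \<omega> in M. h (S (L t \<omega>) \<omega>) = h (F (X \<omega>) (Y \<omega> t))"
      using F_eq L by eventually_elim (simp add: Y_t)
  qed
  also have "\<dots> = (\<integral>\<^sup>+x. h (F (fst x) (snd x t)) \<partial>distr M (P \<Otimes>\<^sub>M P) (\<lambda>\<omega>. (X \<omega>, Y \<omega>)))"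
    using hFt by (subst nn_integral_distr) simp_all
  also have "\<dots> = (\<integral>\<^sup>+q. \<integral>\<^sup>+p. h (F p (q t)) \<partial>distr M P X \<partial>distr M P Y)"
    unfolding prod[symmetric] using XY.nn_integral_snd[OF hFt'] by simp
  also have "\<dots> = (\<integral>\<^sup>+\<omega>. \<integral>\<^sup>+p. h (F p (Y \<omega> t)) \<partial>distr M P X \<partial>M)"
  proof (rule nn_integral_distr)
    have "(\<lambda>(q, p). h (F p (q t))) \<in> borel_measurable (P \<Otimes>\<^sub>M P)"
      using measurable_compose[OF measurable_pair_swap' hFt] by (simp add: case_prod_unfold)
    then have "(\<lambda>(q, p). h (F p (q t))) \<in> borel_measurable (distr M P Y \<Otimes>\<^sub>M distr M P X)"
      by (simp cong: measurable_cong_sets sets_pair_measure_cong)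
    then show "(\<lambda>q. \<integral>\<^sup>+p. h (F p (q t)) \<partial>distr M P X) \<in> borel_measurable (distr M P Y)"
      by (rule X.borel_measurable_nn_integral)
  qed measurable
  also have "\<dots> = (\<integral>\<^sup>+\<omega>. \<integral>\<^sup>+\<omega>'. h (F (X \<omega>') (Y \<omega> t)) \<partial>M \<partial>M)"
  proof (intro nn_integral_cong nn_integral_distr)
    fix \<omega>
    have "(\<lambda>p. h (F p (Y \<omega> t))) \<in> borel_measurable P"
      using measurable_compose[OF measurable_Pair2'[of "Y \<omega> t" borel P] hF] by simp
    then show "(\<lambda>p. h (F p (Y \<omega> t))) \<in> borel_measurable (distr M P X)" by simp
  qed measurable
  also have "\<dots> = (\<integral>\<^sup>+\<omega>. \<integral>\<^sup>+\<omega>'. h (F (X \<omega>') (L t \<omega>)) \<partial>M \<partial>M)" by (simp add: Y_t)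
  also have "\<dots> = (\<integral>\<^sup>+\<omega>. \<integral>\<^sup>+\<omega>'. h (S (L t \<omega>) \<omega>') \<partial>M \<partial>M)"
  proof (rule nn_integral_cong_AE)
    show "AE \<omega> in M. (\<integral>\<^sup>+\<omega>'. h (F (X \<omega>') (L t \<omega>)) \<partial>M) = (\<integral>\<^sup>+\<omega>'. h (S (L t \<omega>) \<omega>') \<partial>M)"
      using L
    proof eventually_elim
      case (elim \<omega>)
      have "AE \<omega>' in M. h (F (X \<omega>') (L t \<omega>)) = h (S (L t \<omega>) \<omega>')"
        using F_eq by eventually_elim (simp add: elim)
      then show ?case by (rule nn_integral_cong_AE)
    qed
  qed
  finally show ?thesis .
qed

lemma log_mgf_time_changed_levy:
  assumes levy: "levy_process M S" and indep: "indep_processes M S L"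
    and "t \<ge> 0" and L: "AE \<omega> in M. 0 \<le> L t \<omega>"
    and kappa: "kappa M S \<theta> = ereal k"
  shows "log_mgf M (\<lambda>\<omega>. S (L t \<omega>) \<omega>) \<theta> = log_mgf M (L t) k"
proof -
  have "prob_space M" using levy by (simp add: levy_process_def)
  moreover have "AE \<omega> in M. \<forall>s\<ge>0. ((\<lambda>u. S u \<omega>) \<longlongrightarrow> S s \<omega>) (at_right s)"
    using levy unfolding levy_process_def cadlag_path_def by (auto elim!: eventually_mono)
  ultimately have "(\<integral>\<^sup>+\<omega>. ennreal (exp (\<theta> * S (L t \<omega>) \<omega>)) \<partial>M)
      = (\<integral>\<^sup>+\<omega>. \<integral>\<^sup>+\<omega>'. ennreal (exp (\<theta> * S (L t \<omega>) \<omega>')) \<partial>M \<partial>M)"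
    by (rule nn_integral_independent_time_change[OF _ _ indep \<open>t \<ge> 0\<close> L]) simp
  also have "\<dots> = (\<integral>\<^sup>+\<omega>. ennreal (exp (k * L t \<omega>)) \<partial>M)"
    using L by (intro nn_integral_cong_AE) (auto simp: levy_process_mgf[OF levy kappa])
  finally show ?thesis by (simp add: log_mgf_def)
qed

section \<open>Large deviations of the time-changed process\<close>

theorem proposition5p1:
  fixes M :: "'a measure"
    and S L :: "real \<Rightarrow> 'a \<Rightarrow> real"
    and f :: "real \<Rightarrow> real"
  assumes levy: "levy_process M S"
    and kappa_finite: "\<forall>\<^sub>F \<theta> in nhds 0. \<bar>kappa M S \<theta>\<bar> \<noteq> \<infinity>"
    and f_diff: "f differentiable_on {0..}"
    and f_convex: "convex_on {0..} f"
    and f_mono: "mono_on {0..} f"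
    and f_0: "f 0 = 0"
    and f_deriv_0: "(f has_real_derivative 0) (at 0 within {0..})"
    and L_nonneg: "\<forall>t\<ge>0. AE \<omega> in M. 0 \<le> L t \<omega>"
    and indep: "indep_processes M S L"
    and L_limit: "\<forall>\<rho>. ((\<lambda>t. ereal (1 / t) * log_mgf M (L t) \<rho>) \<longlongrightarrow> Upsilon f (ereal \<rho>)) at_top"
    and ess_smooth: "essentially_smooth (Lambda_fS M f S)"
    and SL_rv: "\<forall>t>0. (\<lambda>\<omega>. S (L t \<omega>) \<omega>) \<in> borel_measurable M"
  shows "satisfies_LDP M (\<lambda>t \<omega>. S (L t \<omega>) \<omega> / t) (\<lambda>t. t) (I_LD M f S)
       \<and> good_rate_function (I_LD M f S)"
proof -
  interpret prob_space M using levy by (simp add: levy_process_def)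
  have limit: "((\<lambda>t. ereal (1 / t) * log_mgf M (\<lambda>\<omega>. S (L t \<omega>) \<omega>) \<theta>) \<longlongrightarrow> Lambda_fS M f S \<theta>) at_top"
    if \<theta>: "\<theta> \<in> eff_domain (Lambda_fS M f S)" for \<theta>
  proof -
    \<comment> \<open>On the effective domain \<open>kappa\<close> is a real number \<open>k\<close>, so the moments of the time change are those of \<open>L t\<close> at \<open>k\<close>.\<close>
    have "kappa M S \<theta> \<noteq> - \<infinity>"
      using nn_integral_exp_nonzero[of "S 1" \<theta>] levy
      by (auto simp: kappa_def log_mgf_def elog_def levy_process_def)
    moreover have "kappa M S \<theta> \<noteq> \<infinity>"
      using \<theta> by (auto simp: eff_domain_def Lambda_fS_def Upsilon_def)
    ultimately obtain k where k: "kappa M S \<theta> = ereal k" by (cases "kappa M S \<theta>") auto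
    have "\<forall>\<^sub>F t in at_top. ereal (1 / t) * log_mgf M (L t) k
        = ereal (1 / t) * log_mgf M (\<lambda>\<omega>. S (L t \<omega>) \<omega>) \<theta>"
      using eventually_ge_at_top[of 0]
      by eventually_elim (simp add: log_mgf_time_changed_levy[OF levy indep _ _ k] L_nonneg)
    then show ?thesis
      using Lim_transform_eventually[OF L_limit[rule_format, of k]] by (simp add: Lambda_fS_def k)
  qed
  have "\<forall>\<^sub>F \<theta> in nhds 0. \<theta> \<in> eff_domain (Lambda_fS M f S)"
    using kappa_finite by eventually_elim (auto simp: eff_domain_def Lambda_fS_def Upsilon_def)
  then have "0 \<in> interior (eff_domain (Lambda_fS M f S))"
    by (auto simp: eventually_nhds interior_def)
  from gartner_ellis_real[OF prob_space_axioms SL_rv limit this ess_smooth]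
  show ?thesis by (simp add: I_LD_def[abs_def])
qed

end
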